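(* Let $d\ge 1$ and $n\ge 1$ be integers. (i) If $d$ is even then the graph $\Gamma^p\mathcal C_n(\mathbf R^d)$ is bipartite, the class (colour) of a pointed configuration $\mathcal P$ being given by $\overline a(\mathcal P)\pmod 2$. (ii) If $d$ is odd and $n=2m+1$ is odd then the graph $\Gamma^p\mathcal C_n(\mathbf R^d)$ has two connected components, the function $\overline a(\mathcal P)\pmod 2$ being constant on each component. (iii) If $d$ is odd and $n=2m$ is even then there exists $\pi(n,d)\in\{0,1\}$ such that the numbers of elements $a(\mathcal P)$ and $b(\mathcal P)$ of the two Orchard classes satisfy $a(\mathcal P)\equiv b(\mathcal P)\equiv\pi(n,d)\pmod 2$ for every generic configuration $\mathcal P$ of $n=2m$ points in $\mathbf R^d$.
   Context: A set of $n$ distinct points in $\mathbf R^d$ is a generic configuration if every subset of at most $d+1$ of its points is affinely independent. Two generic configurations $\mathcal P^1,\mathcal P^2\subset\mathbf R^d$ are isomorphic if there is a bijection $\varphi:\mathcal P^1\to\mathcal P^2$ such that for all $P_{i_0},\dots,P_{i_d}\in\mathcal P^1$ the simplices $(P_{i_0},\dots,P_{i_d})$ and $(\varphi(P_{i_0}),\dots,\varphi(P_{i_d}))$ have the same orientation (sign of the determinant of the $d\times d$ matrix with rows $P_{i_1}-P_{i_0},\dots,P_{i_d}-P_{i_0}$). For distinct points $P,Q$ of a generic configuration $\mathcal P$ of $n$ points, $n(P,Q)$ is the number of distinct affine hyperplanes spanned by $d$ distinct elements of $\mathcal P\setminus\{P,Q\}$ which separate $P$ and $Q$. The Orchard relation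 on $\mathcal P$, defined by $P\sim Q$ if $P=Q$ or $n(P,Q)\equiv\binom{n-3}{d-1}\pmod 2$ (with $\binom{m}{k}=m(m-1)\cdots(m-k+1)/k!$), is an equivalence relation with at most two classes. Denote the classes by $\mathcal A(\mathcal P),\mathcal B(\mathcal P)$ (one of them possibly empty) and their numbers of elements by $a(\mathcal P),b(\mathcal P)$. A generic configuration is pointed if one of the two classes has been selected (the possibly empty one may be selected); $\overline a(\mathcal P)$ denotes the number of elements of the selected class. Isomorphisms of pointed configurations are isomorphisms respecting the selected classes. A flip is a continuous path $t\mapsto\mathcal P(t)=(P_1(t),\dots,P_n(t))\in(\mathbf R^d)^n$, $t\in[-1,1]$, with $\{P_1(t),\dots,P_n(t)\}$ a generic configuration of $n$ points for $t\ne0$, such that for $t=0$ there is exactly one set of $d+1$ indices $\{i_0,\dots,i_d\}$ with $P_{i_0}(0),\dots,P_{i_d}(0)$ affinely dependent; moreover any $d$ of these $d+1$ points affinely span one and the same hyperplane, containing all of them, and the simplices $(P_{i_0}(\pm1),\dots,P_{i_d}(\pm1))$ carry opposite orientations. The flipset is $\mathcal F(t)=\{P_{i_0}(t),\dots,P_{i_d}(t)\}$. Flips have the effect that, in terms of indices, the partition into Orchard classes of $\mathcal P(+1)$ is obtained from that of $\mathcal P(-1)$ by moving every point of the flipset to the other class and leaving the other points in their class; a flip of a pointed configuration does not change the selected class outside the flipset, i.e. the (index set of the) selected class of $\mathcal P(+1)$ is the symmetric difference of that of $\mathcal P(-1)$ with the index set of the flipset. $\Gamma^p\mathcal C_n(\mathbf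 R^d)$ is the finite graph whose vertices are the isomorphism classes of pointed generic configurations of $n$ points in $\mathbf R^d$, two vertices being joined by an edge if corresponding pointed configurations (some representatives) can be related by a flip. *)

theory Defs
  imports "HOL-Analysis.Analysis" "HOL-Number_Theory.Cong"
begin

text \<open>The ambient dimension \<open>d\<close> is \<open>CARD('d)\<close>; it is at least 1 because types are nonempty.\<close>

definition generic_config :: "nat \<Rightarrow> (real ^ 'd) set \<Rightarrow> bool" where
  "generic_config n P \<longleftrightarrow> finite P \<and> card P = n \<and>
     (\<forall>T \<subseteq> P. card T \<le> CARD('d) + 1 \<longrightarrow> \<not> affine_dependent T)"

text \<open>Orientation of the simplex with first vertex \<open>p0\<close> and remaining vertices listed by \<open>q\<close>.
  The remaining \<open>d\<close> vertices are indexed by the type \<open>'d\<close> instead of \<open>1, \<dots>, d\<close>. All uses below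
  compare orientations for all lists \<open>q\<close>, so the choice of an enumeration of \<open>'d\<close> is immaterial.\<close>

definition orientation :: "real ^ 'd \<Rightarrow> ('d \<Rightarrow> real ^ 'd) \<Rightarrow> real" where
  "orientation p0 q = sgn (det (\<chi> i. q i - p0))"

definition config_iso :: "(real ^ 'd \<Rightarrow> real ^ 'd) \<Rightarrow> (real ^ 'd) set \<Rightarrow> (real ^ 'd) set \<Rightarrow> bool" where
  "config_iso \<phi> P P' \<longleftrightarrow> bij_betw \<phi> P P' \<and>
     (\<forall>p0 \<in> P. \<forall>q. range q \<subseteq> P \<longrightarrow> orientation (\<phi> p0) (\<phi> \<circ> q) = orientation p0 q)"

section \<open>The Orchard relation\<close>

text \<open>\<open>H\<close> is a hyperplane having \<open>p\<close> and \<open>q\<close> strictly on different sides. The normal vector \<open>a\<close>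
  is automatically nonzero, and replacing \<open>(a, b)\<close> by \<open>(-a, -b)\<close> exchanges \<open>p\<close> and \<open>q\<close>.\<close>

definition separates :: "(real ^ 'd) set \<Rightarrow> real ^ 'd \<Rightarrow> real ^ 'd \<Rightarrow> bool" where
  "separates H p q \<longleftrightarrow> (\<exists>a b. H = {x. a \<bullet> x = b} \<and> a \<bullet> p < b \<and> b < a \<bullet> q)"

definition num_separating :: "(real ^ 'd) set \<Rightarrow> real ^ 'd \<Rightarrow> real ^ 'd \<Rightarrow> nat" where
  "num_separating P p q =
     card {H. separates H p q \<and> (\<exists>T \<subseteq> P - {p, q}. card T = CARD('d) \<and> H = affine hull T)}"

text \<open>\<open>m (m - 1) \<dots> (m - k + 1) / k!\<close> for an integer \<open>m\<close>; it is needed for negative \<open>m = n - 3\<close>.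
  This unfolds \<open>gbinomial\<close> at type \<open>int\<close>, which the sort constraint set by the library does not
  allow to be written as a term. The lemma states that the division is exact.\<close>

definition int_binomial :: "int \<Rightarrow> nat \<Rightarrow> int" where
  "int_binomial m k = (\<Prod>i = 0..<k. m - int i) div fact k"

lemma int_binomial_mult_fact: "int_binomial m k * fact k = (\<Prod>i = 0..<k. m - int i)"
  using gbinomial_int_mult_fact'[of m k] by (simp add: int_binomial_def gbinomial_prod_rev)

definition orchard_rel :: "(real ^ 'd) set \<Rightarrow> ((real ^ 'd) \<times> (real ^ 'd)) set" where
  "orchard_rel P = {(p, q). p \<in> P \<and> q \<in> P \<and>
     (p = q \<or> [int (num_separating P p q) = int_binomial (int (card P) - 3) (CARD('d) - 1)] (mod 2))}"

text \<open>The two Orchard classes. If all points are equivalent, then the second class is empty.\<close>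

definition orchard_classes :: "(real ^ 'd) set \<Rightarrow> (real ^ 'd) set set" where
  "orchard_classes P =
     P // orchard_rel P \<union> (if card (P // orchard_rel P) = 1 then {{}} else {})"

section \<open>Pointed configurations and flips\<close>

text \<open>A pointed configuration is a configuration together with its selected Orchard class.\<close>

type_synonym 'd pconfig = "(real ^ 'd) set \<times> (real ^ 'd) set"

definition pconfigs :: "nat \<Rightarrow> ('d::finite) pconfig set" where
  "pconfigs n = {(P, S). generic_config n P \<and> S \<in> orchard_classes P}"

definition pconfig_iso_rel :: "nat \<Rightarrow> (('d::finite) pconfig \<times> 'd pconfig) set" where
  "pconfig_iso_rel n = {((P, S), (P', S')). (P, S) \<in> pconfigs n \<and> (P', S') \<in> pconfigs n \<and>
     (\<exists>\<phi>. config_iso \<phi> P P' \<and> \<phi> ` S = S')}"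

text \<open>Affine dependence of an indexed family. In contrast to \<open>affine_dependent\<close> for sets, a family
  with a repeated point is dependent. This matters for \<open>d = 1\<close>, where a flip makes two points
  coincide.\<close>

definition affine_dependent_family :: "('i \<Rightarrow> real ^ 'd) \<Rightarrow> 'i set \<Rightarrow> bool" where
  "affine_dependent_family p I \<longleftrightarrow>
     (\<exists>u :: 'i \<Rightarrow> real. sum u I = 0 \<and> (\<exists>i \<in> I. u i \<noteq> 0) \<and> (\<Sum>i \<in> I. u i *\<^sub>R p i) = 0)"

text \<open>\<open>flip n \<gamma> I\<close>: the path \<open>t \<mapsto> (\<gamma> t 1, \<dots>, \<gamma> t n)\<close>, \<open>t \<in> [-1, 1]\<close>, is a flip whose flipset has
  index set \<open>I\<close>.\<close>

definition flip :: "nat \<Rightarrow> (real \<Rightarrow> nat \<Rightarrow> real ^ 'd) \<Rightarrow> nat set \<Rightarrow> bool" where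
  "flip n \<gamma> I \<longleftrightarrow>
     (\<forall>i \<in> {1..n}. continuous_on {-1..1} (\<lambda>t. \<gamma> t i)) \<and>
     (\<forall>t \<in> {-1..1} - {0}. generic_config n (\<gamma> t ` {1..n})) \<and>
     {J. J \<subseteq> {1..n} \<and> card J = CARD('d) + 1 \<and> affine_dependent_family (\<gamma> 0) J} = {I} \<and>
     (\<exists>a b. a \<noteq> 0 \<and> (\<forall>i \<in> I. \<gamma> 0 i \<in> {x. a \<bullet> x = b}) \<and>
        (\<forall>J \<subseteq> I. card J = CARD('d) \<longrightarrow> affine hull (\<gamma> 0 ` J) = {x. a \<bullet> x = b})) \<and>
     (\<forall>i0 \<in> I. \<forall>e :: 'd \<Rightarrow> nat. bij_betw e UNIV (I - {i0}) \<longrightarrow>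
        orientation (\<gamma> 1 i0) (\<gamma> 1 \<circ> e) = - orientation (\<gamma> (-1) i0) (\<gamma> (-1) \<circ> e))"

text \<open>The flip changes the index set of the selected class by the symmetric difference with the
  index set of the flipset.\<close>

definition pointed_flip :: "nat \<Rightarrow> ('d::finite) pconfig \<Rightarrow> 'd pconfig \<Rightarrow> bool" where
  "pointed_flip n = (\<lambda>(P, S) (P', S'). (P, S) \<in> pconfigs n \<and> (P', S') \<in> pconfigs n \<and>
     (\<exists>\<gamma> I. flip n \<gamma> I \<and> P = \<gamma> (-1) ` {1..n} \<and> P' = \<gamma> 1 ` {1..n} \<and>
        {i \<in> {1..n}. \<gamma> 1 i \<in> S'} = sym_diff {i \<in> {1..n}. \<gamma> (-1) i \<in> S} I))"

section \<open>The graph of pointed configurations\<close>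

text \<open>Undirected graphs are given by a vertex set and a set of edges \<open>{x, y}\<close>; a singleton is a
  loop.\<close>

definition flip_graph_verts :: "nat \<Rightarrow> ('d::finite) pconfig set set" where
  "flip_graph_verts n = pconfigs n // pconfig_iso_rel n"

definition flip_graph_edges :: "nat \<Rightarrow> ('d::finite) pconfig set set set" where
  "flip_graph_edges n = {{X, Y} | X Y. X \<in> flip_graph_verts n \<and> Y \<in> flip_graph_verts n \<and>
     (\<exists>x \<in> X. \<exists>y \<in> Y. pointed_flip n x y)}"

definition is_bipartition :: "'v set \<Rightarrow> 'v set set \<Rightarrow> 'v set \<Rightarrow> 'v set \<Rightarrow> bool" where
  "is_bipartition V E A B \<longleftrightarrow> A \<union> B = V \<and> A \<inter> B = {} \<and> (\<forall>e \<in> E. \<exists>x \<in> A. \<exists>y \<in> B. e = {x, y})"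

text \<open>Vertex sets of the connected components.\<close>

definition connected_components :: "'v set \<Rightarrow> 'v set set \<Rightarrow> 'v set set" where
  "connected_components V E = V // {(x, y). x \<in> V \<and> y \<in> V \<and> (x, y) \<in> {(u, v). {u, v} \<in> E}\<^sup>*}"

text \<open>Vertices on all of whose representatives the number of elements of the selected class is
  congruent to \<open>k\<close> modulo 2.\<close>

definition parity_verts :: "nat \<Rightarrow> nat \<Rightarrow> ('d::finite) pconfig set set" where
  "parity_verts n k = {X \<in> flip_graph_verts n. \<forall>(P, S) \<in> X. [card S = k] (mod 2)}"

end

theory Submission
  imports Defs
begin

text \<open>The argument rests on two facts about orientations. The hyperplane spanned by \<open>d\<close> points \<open>T\<close>
  separates \<open>p\<close> and \<open>q\<close> if and only if the determinants of the simplices \<open>(p, T)\<close> and \<open>(q, T)\<close> have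
  opposite signs (\<open>separates_iff_det\<close>), and the determinant is antisymmetric and affine in each vertex.
  Antisymmetry gives \<open>n(P, Q) + n(Q, R) + n(P, R) \<equiv> binomial (n - 3, d - 1)\<close> modulo 2
  (\<open>num_separating_triple\<close>), so that the Orchard relation has at most two classes
  (\<open>orchard_classes_eq\<close>). Reversing the orientation of the single simplex \<open>I\<close> changes the parity of
  \<open>n(P, Q)\<close> exactly when one of \<open>P\<close>, \<open>Q\<close> lies in \<open>I\<close>, so that it moves the points of \<open>I\<close> to the other class
  (\<open>orchard_classes_orientation_change\<close>).

  A flip replaces the selected class by its symmetric difference with \<open>d + 1\<close> points. Hence it changes the
  parity of the selected class if \<open>d\<close> is even, which is (i), and preserves it if \<open>d\<close> is odd.

  For (ii), any two generic configurations are related by flips and isomorphisms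
  (\<open>linked_generic_configs\<close>): the points are moved one at a time along segments, and since all
  determinants are affine in the moving point, a choice of segments that avoids finitely many
  hyperplanes makes at most one determinant vanish at any time (\<open>linked_move_point\<close>). The path
  carries the selected class along. As \<open>n\<close> is odd, the two classes of a configuration have different
  parities, so the parity determines the component, and both parities occur.

  For (iii) no flips are needed. If \<open>n\<close> is even and \<open>d\<close> is odd, then the number \<open>a b\<close> of inequivalent
  pairs has the parity of \<open>a\<close>. It is congruent to the sum of \<open>n(P, Q) + binomial (n - 3, d - 1)\<close> over all pairs,
  and the sum of the \<open>n(P, Q)\<close> is the sum of \<open>l r\<close> over all hyperplanes, \<open>l\<close> and \<open>r\<close> being the
  numbers of points on the two sides. As \<open>l + r = n - d\<close> is odd, every \<open>l r\<close> is even
  (\<open>card_orchard_class_parity\<close>).\<close>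

section \<open>Determinants of simplices\<close>

text \<open>The signed volume of a simplex (up to the factor \<open>d!\<close>), whose sign is the orientation.\<close>

definition simplex_det :: "real ^ 'd \<Rightarrow> ('d \<Rightarrow> real ^ 'd) \<Rightarrow> real" where
  "simplex_det p q = det (\<chi> i. q i - p)"

lemma orientation_eq_sgn: "orientation p q = sgn (simplex_det p q)"
  by (simp add: orientation_def simplex_det_def)

text \<open>Subtracting row \<open>j\<close> from all other rows leaves \<open>p\<close> in one row only; hence the determinant is
  affine in \<open>p\<close>, although \<open>p\<close> occurs in every row of its definition.\<close>

lemma simplex_det_pivot:
  fixes p :: "real ^ 'd" and q :: "'d \<Rightarrow> real ^ 'd"
  shows "simplex_det p q = det (\<chi> i. if i = j then q j - p else q i - q j)"
proof -
  \<comment> \<open>One row operation for each element of \<open>S\<close>; at the end \<open>S\<close> is the complement of \<open>{j}\<close>.\<close>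
  have "det (\<chi> i. if i \<in> S then q i - q j else q i - p) = simplex_det p q"
    if "j \<notin> S" for S :: "'d set"
    using finite[of S] that
  proof (induction S rule: finite_induct)
    case empty
    then show ?case by (simp add: simplex_det_def)
  next
    case (insert k S)
    let ?A = "(\<chi> i. if i \<in> S then q i - q j else q i - p) :: real ^ 'd ^ 'd"
    have "det (\<chi> i. if i = k then row k ?A + (-1) *s row j ?A else row i ?A) = det ?A"
      using insert.prems by (intro det_row_operation) auto
    moreover have "(\<chi> i. if i = k then row k ?A + (-1) *s row j ?A else row i ?A) =
        (\<chi> i. if i \<in> insert k S then q i - q j else q i - p)"
      using insert by (auto simp: vec_eq_iff row_def)
    ultimately show ?case using insert by simp
  qed
  from this[of "- {j}"] show ?thesis
    by (simp add: if_distrib cong: if_cong) (smt (verit) Cart_lambda_cong)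
qed

text \<open>Exchanging the first vertex with any other vertex reverses the orientation.\<close>

lemma simplex_det_swap: "simplex_det p (q(j := x)) = - simplex_det x (q(j := p))"
proof -
  have "simplex_det x (q(j := p)) = det (\<chi> i. if i = j then (-1) *s (x - p) else q i - p)"
    by (subst simplex_det_pivot[of _ _ j]) (auto intro!: arg_cong[of _ _ det] simp: vec_eq_iff)
  also have "\<dots> = - det (\<chi> i. if i = j then x - p else q i - p)"
    by (subst det_row_mul) simp
  also have "(\<chi> i. if i = j then x - p else q i - p) = (\<chi> i. (q(j := x)) i - p)"
    by (auto simp: vec_eq_iff)
  finally show ?thesis by (simp add: simplex_det_def)
qed

lemma simplex_det_eq_0_iff:
  fixes p :: "real ^ 'd" and q :: "'d \<Rightarrow> real ^ 'd"
  shows "simplex_det p q = 0 \<longleftrightarrow> (\<exists>u. (\<Sum>i\<in>UNIV. u i *\<^sub>R (q i - p)) = 0 \<and> (\<exists>i. u i \<noteq> 0))"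
proof -
  let ?A = "(\<chi> i. q i - p) :: real ^ 'd ^ 'd"
  have row: "row k ?A = q k - p" for k by (simp add: row_def vec_eq_iff)
  have "simplex_det p q \<noteq> 0 \<longleftrightarrow> (\<exists>B. ?A ** B = mat 1)"
    unfolding simplex_det_def invertible_det_nz[symmetric] invertible_right_inverse ..
  also have "\<dots> \<longleftrightarrow> (\<forall>u. (\<Sum>i\<in>UNIV. u i *\<^sub>R row i ?A) = 0 \<longrightarrow> (\<forall>i. u i = 0))"
    unfolding scalar_mult_eq_scaleR[symmetric] by (rule matrix_right_invertible_independent_rows)
  finally show ?thesis using row by auto
qed

lemma det_row_inner:
  fixes A :: "'d \<Rightarrow> real ^ 'd"
  shows "\<exists>a. \<forall>x. det (\<chi> i. if i = j then x else A i) = a \<bullet> x"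
proof -
  let ?f = "\<lambda>x. det (\<chi> i. if i = j then x else A i)"
  have "linear ?f"
  proof (rule linearI)
    show "?f (x + y) = ?f x + ?f y" for x y by (rule det_row_add)
    show "?f (r *\<^sub>R x) = r *\<^sub>R ?f x" for r x
      using det_row_mul[of j r "\<lambda>_. x" A] unfolding scalar_mult_eq_scaleR by simp
  qed
  then have "?f x = adjoint ?f 1 \<bullet> x" for x
    using adjoint_works[of ?f x 1] by (simp add: inner_commute)
  then show ?thesis by blast
qed

lemma simplex_det_affine_base:
  fixes q :: "'d \<Rightarrow> real ^ 'd"
  shows "\<exists>a b. \<forall>x. simplex_det x q = a \<bullet> x - b"
proof -
  fix j :: 'd
  obtain a where a: "\<And>x. det (\<chi> i. if i = j then x else q i - q j) = a \<bullet> x"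
    using det_row_inner[of j "\<lambda>i. q i - q j"] by blast
  have "simplex_det x q = (- a) \<bullet> x - (- (a \<bullet> q j))" for x
    by (subst simplex_det_pivot[of _ _ j]) (simp add: a inner_diff_right)
  then show ?thesis by blast
qed

lemma simplex_det_affine_vertex: "\<exists>a b. \<forall>x. simplex_det p (q(j := x)) = a \<bullet> x - b"
proof -
  obtain a b where "\<And>x. simplex_det x (q(j := p)) = a \<bullet> x - b"
    using simplex_det_affine_base by blast
  then have "simplex_det p (q(j := x)) = (- a) \<bullet> x - (- b)" for x
    by (subst simplex_det_swap) simp
  then show ?thesis by blast
qed

lemma sum_vertices:
  fixes f :: "'i \<Rightarrow> 'a::comm_monoid_add"
  assumes "i \<in> J" and e: "bij_betw e (UNIV :: 'd::finite set) (J - {i})"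
  shows "sum f J = f i + (\<Sum>k\<in>UNIV. f (e k))"
proof -
  have "finite J" using bij_betw_finite[OF e] by simp
  then show ?thesis
    using sum.remove[of J i f] sum.reindex_bij_betw[OF e, of f] assms(1) by simp
qed

lemma affine_dependent_family_iff:
  fixes c :: "'i \<Rightarrow> real ^ 'd"
  assumes "i \<in> J" and e: "bij_betw e (UNIV :: 'd set) (J - {i})"
  shows "affine_dependent_family c J \<longleftrightarrow> simplex_det (c i) (c \<circ> e) = 0"
proof -
  have fin: "finite (J - {i})" using bij_betw_finite[OF e] by simp
  then have finJ: "finite J" by simp
  have inj: "inj e" and ran: "range e = J - {i}" using e by (auto simp: bij_betw_def)
  note spl = sum_vertices[OF assms]
  show ?thesis
  proof
    assume "affine_dependent_family c J"
    then obtain u where u: "sum u J = 0" "\<exists>i\<in>J. u i \<noteq> 0" "(\<Sum>i\<in>J. u i *\<^sub>R c i) = 0"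
      by (auto simp: affine_dependent_family_def)
    have ui: "u i = - (\<Sum>k\<in>UNIV. u (e k))" using u(1) spl[of u] by simp
    have "(\<Sum>k\<in>UNIV. u (e k) *\<^sub>R ((c \<circ> e) k - c i)) =
        (\<Sum>k\<in>UNIV. u (e k) *\<^sub>R c (e k)) + u i *\<^sub>R c i"
      by (simp add: ui algebra_simps sum_subtractf scaleR_sum_left)
    also have "\<dots> = 0" using u(3) spl[of "\<lambda>i. u i *\<^sub>R c i"] by (simp add: add.commute)
    finally have 1: "(\<Sum>k\<in>UNIV. u (e k) *\<^sub>R ((c \<circ> e) k - c i)) = 0" .
    have "\<exists>k. u (e k) \<noteq> 0"
    proof (rule ccontr)
      assume "\<not> ?thesis"
      then have z: "u (e k) = 0" for k by blast
      then have "u i = 0" using ui by simp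
      moreover have "u j = 0" if "j \<in> J - {i}" for j using that z ran by (metis imageE)
      ultimately show False using u(2) by blast
    qed
    then show "simplex_det (c i) (c \<circ> e) = 0"
      unfolding simplex_det_eq_0_iff using 1 by (intro exI[of _ "u \<circ> e"]) simp
  next
    assume "simplex_det (c i) (c \<circ> e) = 0"
    then obtain v where v: "(\<Sum>k\<in>UNIV. v k *\<^sub>R (c (e k) - c i)) = 0" "\<exists>k. v k \<noteq> 0"
      unfolding simplex_det_eq_0_iff by auto
    define u where "u j = (if j = i then - sum v UNIV else v (inv e j))" for j
    have ue: "u (e k) = v k" for k
    proof -
      have "e k \<noteq> i" using ran by blast
      then show ?thesis using inj by (simp add: u_def)
    qed
    have "sum u J = 0" by (simp add: spl ue) (simp add: u_def)
    moreover have "\<exists>j\<in>J. u j \<noteq> 0" using v(2) ue ran by (metis DiffD1 rangeI)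
    moreover have "(\<Sum>j\<in>J. u j *\<^sub>R c j) = 0"
      using v(1) by (simp add: spl ue) (simp add: u_def algebra_simps sum_subtractf scaleR_sum_left)
    ultimately show "affine_dependent_family c J" unfolding affine_dependent_family_def by blast
  qed
qed

lemma simplex_det_not_inj:
  assumes "\<not> inj e \<or> i \<in> range e"
  shows "simplex_det (c i) (c \<circ> e) = 0"
  using assms
proof
  assume "\<not> inj e"
  then obtain k l where "k \<noteq> l" "e k = e l" by (auto simp: inj_def)
  then show ?thesis unfolding simplex_det_def
    by (intro det_identical_rows[of k l]) (auto simp: row_def)
next
  assume "i \<in> range e"
  then obtain k where "e k = i" by auto
  then show ?thesis unfolding simplex_det_def
    by (intro det_zero_row(1)[of k]) (auto simp: row_def vec_eq_iff)
qed

lemma affine_dependent_family_inj: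
  assumes "inj_on c I" "finite I"
  shows "affine_dependent_family c I \<longleftrightarrow> affine_dependent (c ` I)"
proof -
  have "affine_dependent (c ` I) \<longleftrightarrow> (\<exists>U. sum U (c ` I) = 0 \<and> (\<exists>v\<in>c ` I. U v \<noteq> 0) \<and> (\<Sum>v\<in>c ` I. U v *\<^sub>R v) = 0)"
    using assms by (simp add: affine_dependent_explicit_finite)
  also have "\<dots> \<longleftrightarrow> affine_dependent_family c I"
    unfolding affine_dependent_family_def
  proof safe
    fix U i assume "sum U (c ` I) = 0" "(\<Sum>v\<in>c ` I. U v *\<^sub>R v) = 0" "i \<in> I" "U (c i) \<noteq> 0"
    then show "\<exists>u. sum u I = 0 \<and> (\<exists>i\<in>I. u i \<noteq> 0) \<and> (\<Sum>i\<in>I. u i *\<^sub>R c i) = 0"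
      using assms(1) by (intro exI[of _ "U \<circ> c"]) (auto simp: sum.reindex)
  next
    fix u i assume u: "sum u I = 0" "(\<Sum>v\<in>I. u v *\<^sub>R c v) = 0" "i \<in> I" "u i \<noteq> 0"
    have [simp]: "u (inv_into I c (c i)) = u i" if "i \<in> I" for i using that assms by simp
    show "\<exists>U. sum U (c ` I) = 0 \<and> (\<exists>v\<in>c ` I. U v \<noteq> 0) \<and> (\<Sum>v\<in>c ` I. U v *\<^sub>R v) = 0"
      using assms(1) u by (intro exI[of _ "u \<circ> inv_into I c"]) (auto simp: sum.reindex)
  qed
  finally show ?thesis by simp
qed

lemma affine_dependent_family_not_inj:
  assumes "\<not> inj_on c I" "finite I"
  shows "affine_dependent_family c I"
proof -
  obtain i j where ij: "i \<in> I" "j \<in> I" "i \<noteq> j" "c i = c j" using assms by (auto simp: inj_on_def)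
  define u :: "'a \<Rightarrow> real" where "u k = of_bool (k = i) - of_bool (k = j)" for k
  have s: "(\<Sum>k\<in>I. u k *\<^sub>R f k) = f i - f j" for f :: "'a \<Rightarrow> 'z::real_vector"
    using ij assms by (simp add: u_def scaleR_diff_left sum_subtractf of_bool_def if_distrib
        [of "\<lambda>x. x *\<^sub>R _"] cong: if_cong)
  have "sum u I = 0" using s[of "\<lambda>_. 1::real"] by simp
  moreover have "(\<Sum>k\<in>I. u k *\<^sub>R c k) = 0" using s[of c] ij by simp
  moreover have "u i \<noteq> 0" using ij by (simp add: u_def)
  ultimately show ?thesis using ij unfolding affine_dependent_family_def by blast
qed

lemma affine_hull_eq_hyperplane:
  fixes a :: "real ^ 'd"
  assumes "\<not> affine_dependent T" "card T = CARD('d)" "T \<subseteq> {x. a \<bullet> x = b}" "a \<noteq> 0"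
  shows "affine hull T = {x. a \<bullet> x = b}"
proof (rule affine_dim_equal)
  show "affine hull T \<subseteq> {x. a \<bullet> x = b}" using assms by (simp add: affine_hyperplane hull_minimal)
  show "affine hull T \<noteq> {}" using assms(2) by auto
  show "aff_dim (affine hull T) = aff_dim {x. a \<bullet> x = b}"
    using assms aff_dim_affine_independent[OF assms(1)] by simp
qed (simp_all add: affine_hyperplane)

text \<open>The hyperplane through \<open>T\<close> separates \<open>p\<close> from \<open>q\<close> if and only if the two simplices that they
  span with \<open>T\<close> have opposite orientations. So the Orchard relation depends on orientations only.\<close>

lemma separates_iff_det:
  fixes T :: "(real ^ 'd) set"
  assumes e: "bij_betw e UNIV T" and p: "simplex_det p e \<noteq> 0" and q: "simplex_det q e \<noteq> 0"
  shows "separates (affine hull T) p q \<longleftrightarrow> simplex_det p e * simplex_det q e < 0"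
proof -
  obtain a b where ab: "\<And>x. simplex_det x e = a \<bullet> x - b" using simplex_det_affine_base by blast
  have ranT: "range e = T" "inj e" using e by (auto simp: bij_betw_def)
  have on: "simplex_det x e = 0" if "x \<in> T" for x
    using simplex_det_not_inj[of "e" x id] that ranT by auto
  have "p \<notin> T" using on p by blast
  then have "bij_betw e UNIV (insert p T - {p})" using e by simp
  then have "\<not> affine_dependent_family id (insert p T)"
    using p affine_dependent_family_iff[of p "insert p T" e id] by (simp add: comp_def)
  moreover have finT: "finite T" using ranT by auto
  ultimately have "\<not> affine_dependent (insert p T)"
    using affine_dependent_family_inj[of id "insert p T"] by simp
  then have indT: "\<not> affine_dependent T" using affine_dependent_subset by blast
  have a0: "a \<noteq> 0"
  proof
    assume "a = 0"
    then have "simplex_det p e = simplex_det (e undefined) e" by (simp add: ab)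
    then show False using on[of "e undefined"] ranT p by auto
  qed
  have hull: "affine hull T = {x. a \<bullet> x = b}"
  proof (rule affine_hull_eq_hyperplane[OF indT _ _ a0])
    show "card T = CARD('d)" using bij_betw_same_card[OF e] by simp
    show "T \<subseteq> {x. a \<bullet> x = b}" using on ab by force
  qed
  show ?thesis
  proof
    assume "separates (affine hull T) p q"
    then obtain a' b' where 1: "{x. a \<bullet> x = b} = {x. a' \<bullet> x = b'}" "a' \<bullet> p < b'" "b' < a' \<bullet> q"
      unfolding separates_def hull by blast
    \<comment> \<open>The hyperplane may be given by other data \<open>a'\<close>, \<open>b'\<close>; the point \<open>x\<close> where it meets the segment
      from \<open>p\<close> to \<open>q\<close> is a zero of \<open>a \<bullet> x - b\<close> in the interior of the segment.\<close>
    define t where "t = (b' - a' \<bullet> p) / (a' \<bullet> q - a' \<bullet> p)"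
    have t: "0 < t" "t < 1" using 1 by (auto simp: t_def field_simps)
    define x where "x = (1 - t) *\<^sub>R p + t *\<^sub>R q"
    have "t * (a' \<bullet> q - a' \<bullet> p) = b' - a' \<bullet> p" using 1 by (simp add: t_def)
    then have "a' \<bullet> x = b'" by (simp add: x_def inner_add_right algebra_simps)
    then have "a \<bullet> x = b" using 1(1) by blast
    then have "(1 - t) * (a \<bullet> p - b) + t * (a \<bullet> q - b) = 0"
      by (simp add: x_def inner_add_right algebra_simps)
    then have "(1 - t) * simplex_det p e = - t * simplex_det q e" by (simp add: ab)
    then have "(1 - t) * (simplex_det p e * simplex_det q e) = - (t * (simplex_det q e)\<^sup>2)"
      by (simp add: power2_eq_square mult.assoc[symmetric])
    moreover have "t * (simplex_det q e)\<^sup>2 > 0" using t q by simp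
    ultimately have "(1 - t) * (simplex_det p e * simplex_det q e) < 0" by linarith
    then show "simplex_det p e * simplex_det q e < 0" using t
      by (simp add: mult_less_0_iff)
  next
    assume "simplex_det p e * simplex_det q e < 0"
    then consider "a \<bullet> p < b" "b < a \<bullet> q" | "a \<bullet> q < b" "b < a \<bullet> p"
      by (auto simp: ab mult_less_0_iff)
    then show "separates (affine hull T) p q"
    proof cases
      case 1
      then show ?thesis unfolding separates_def hull by blast
    next
      case 2
      then have "{x. a \<bullet> x = b} = {x. (- a) \<bullet> x = - b} \<and> (- a) \<bullet> p < - b \<and> - b < (- a) \<bullet> q"
        by auto
      then show ?thesis unfolding separates_def hull by blast
    qed
  qed
qed

section \<open>Separating hyperplanes and the Orchard relation\<close>

lemma generic_configD:
  fixes P :: "(real ^ 'd) set"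
  assumes "generic_config n P"
  shows "finite P" "card P = n"
    "\<And>T. T \<subseteq> P \<Longrightarrow> card T \<le> CARD('d) + 1 \<Longrightarrow> \<not> affine_dependent T"
  using assms by (auto simp: generic_config_def)

lemma ex_enumeration:
  assumes "card T = CARD('d::finite)"
  obtains e :: "'d::finite \<Rightarrow> 'a" where "bij_betw e UNIV T"
proof -
  have "finite T" using assms by (metis card.infinite zero_less_card_finite less_irrefl)
  then show ?thesis using that finite_same_card_bij[of "UNIV :: 'd set" T] assms by auto
qed

lemma generic_simplex_det_nonzero:
  fixes P :: "(real ^ 'd) set"
  assumes P: "generic_config n P" and "p \<in> P" "bij_betw e UNIV T" "T \<subseteq> P - {p}"
  shows "simplex_det p e \<noteq> 0"
proof -
  have fin: "finite T" using bij_betw_finite[OF assms(3)] by simp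
  have "card (insert p T) = CARD('d) + 1"
    using assms(4) bij_betw_same_card[OF assms(3)] fin by (subst card_insert_disjoint) auto
  then have "\<not> affine_dependent (insert p T)" using generic_configD(3)[OF P, of "insert p T"] assms by auto
  then have "\<not> affine_dependent_family id (insert p T)"
    using affine_dependent_family_inj[of id "insert p T"] fin by simp
  moreover have "insert p T - {p} = T" using assms(4) by auto
  ultimately show ?thesis
    using affine_dependent_family_iff[of p "insert p T" e id] assms(3) by (simp add: comp_def)
qed

text \<open>In a generic configuration different \<open>d\<close>-subsets span different hyperplanes, so subsets may be
  counted instead of hyperplanes.\<close>

lemma num_separating_eq:
  fixes P :: "(real ^ 'd) set"
  assumes P: "generic_config n P"
  shows "num_separating P p q =
    card {T. T \<subseteq> P - {p, q} \<and> card T = CARD('d) \<and> separates (affine hull T) p q}"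
proof -
  let ?S = "{T. T \<subseteq> P - {p, q} \<and> card T = CARD('d) \<and> separates (affine hull T) p q}"
  have sub: "T \<subseteq> T'" if "T \<in> ?S" "T' \<in> ?S" "affine hull T = affine hull T'" for T T'
  proof
    fix x assume "x \<in> T"
    show "x \<in> T'"
    proof (rule ccontr)
      assume x: "x \<notin> T'"
      have "finite T'" using that(2) generic_configD(1)[OF P] by (auto intro: finite_subset)
      then have "card (insert x T') = CARD('d) + 1" using x that(2) by simp
      moreover have "insert x T' \<subseteq> P" using \<open>x \<in> T\<close> that by auto
      ultimately have "\<not> affine_dependent (insert x T')"
        using generic_configD(3)[OF P, of "insert x T'"] by auto
      moreover have "x \<in> affine hull T'" using \<open>x \<in> T\<close> that(3) hull_inc by metis
      ultimately show False using x by (auto simp: affine_dependent_def)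
    qed
  qed
  have "inj_on (\<lambda>T. affine hull T) ?S"
    by (intro inj_onI subset_antisym) (erule (2) sub, erule sub, assumption, erule sym)
  moreover have "{H. separates H p q \<and> (\<exists>T \<subseteq> P - {p, q}. card T = CARD('d) \<and> H = affine hull T)} =
      (\<lambda>T. affine hull T) ` ?S" by auto
  ultimately show ?thesis unfolding num_separating_def by (simp add: card_image)
qed

lemma separates_commute: "separates H p q \<longleftrightarrow> separates H q p"
proof -
  have "separates H q p" if sep: "separates H p q" for p q
  proof -
    obtain a b where "H = {x. a \<bullet> x = b}" "a \<bullet> p < b" "b < a \<bullet> q"
      using sep by (auto simp: separates_def)
    then have "H = {x. (- a) \<bullet> x = - b}" "(- a) \<bullet> q < - b" "- b < (- a) \<bullet> p" by auto
    then show ?thesis unfolding separates_def by blast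
  qed
  then show ?thesis by blast
qed

lemma num_separating_commute: "num_separating P p q = num_separating P q p"
  by (simp add: num_separating_def separates_commute[of _ p q] insert_commute)

lemma int_binomial_of_nat: "int_binomial (int m) k = int (m choose k)"
proof -
  have "real_of_int (int_binomial (int m) k * fact k) = real_of_int (int (m choose k) * fact k)"
    unfolding int_binomial_mult_fact
    by (simp add: binomial_gbinomial gbinomial_prod_rev)
  then have "int_binomial (int m) k * fact k = int (m choose k) * fact k"
    by (simp only: of_int_eq_iff)
  then show ?thesis by simp
qed

lemma separates_transitive_parity:
  fixes P :: "(real ^ 'd) set"
  assumes P: "generic_config n P" and T: "T \<subseteq> P - {p, q, r}" "card T = CARD('d)"
    and pqr: "p \<in> P" "q \<in> P" "r \<in> P"
  shows "separates (affine hull T) p r \<longleftrightarrow>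
     (separates (affine hull T) p q \<longleftrightarrow> \<not> separates (affine hull T) q r)"
proof -
  obtain e :: "'d \<Rightarrow> real ^ 'd" where e: "bij_betw e UNIV T" using ex_enumeration[OF T(2)] .
  have "simplex_det x e \<noteq> 0" if "x \<in> {p, q, r}" for x
    using generic_simplex_det_nonzero[OF P _ e, of x] T pqr that by auto
  then have nz: "simplex_det p e \<noteq> 0" "simplex_det q e \<noteq> 0" "simplex_det r e \<noteq> 0" by auto
  show ?thesis
    unfolding separates_iff_det[OF e nz(1,3)] separates_iff_det[OF e nz(1,2)]
      separates_iff_det[OF e nz(2,3)] using nz by (auto simp: mult_less_0_iff)
qed

text \<open>If \<open>d \<ge> 2\<close>, then projection along the affine hull of \<open>U\<close> maps \<open>U\<close> to a point of a plane, and of the three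
  lines that join this point to a vertex of the triangle \<open>p q r\<close>, an odd number separates the other
  two vertices. If \<open>d = 1\<close>, then exactly one of three points lies between the other two.
  With \<open>D x y\<close> the determinant of the simplex \<open>(x, U, y)\<close>, the product of the three pairs of
  determinants to be compared is \<open>(D p q D q p) (D p r D r p) (D q r D r q)\<close>, which is negative because
  \<open>D\<close> is antisymmetric.\<close>

lemma separates_triangle_parity:
  fixes P :: "(real ^ 'd) set"
  assumes P: "generic_config n P" and U: "U \<subseteq> P - {p, q, r}" "card U = CARD('d) - 1"
    and pqr: "p \<in> P" "q \<in> P" "r \<in> P" "p \<noteq> q" "p \<noteq> r" "q \<noteq> r"
  shows "separates (affine hull (insert q U)) p r \<longleftrightarrow>
     (separates (affine hull (insert r U)) p q \<longleftrightarrow> separates (affine hull (insert p U)) q r)"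
proof -
  fix j :: 'd
  have finU: "finite U" using U(1) generic_configD(1)[OF P] by (auto intro: finite_subset)
  have "card (UNIV - {j}) = card U" using U(2) by (simp add: card_Diff_singleton)
  then obtain u where u: "bij_betw u (UNIV - {j}) U"
    using finite_same_card_bij[of "UNIV - {j}" U] finU by auto
  have bij: "bij_betw (u(j := x)) UNIV (insert x U)" if "x \<in> {p, q, r}" for x
  proof -
    have "bij_betw (u(j := x)) (UNIV - {j}) U"
      using u by (subst bij_betw_cong[of _ _ u]) auto
    then have "bij_betw (u(j := x)) (insert j (UNIV - {j})) (insert ((u(j := x)) j) U)"
      using that U(1) by (subst notIn_Un_bij_betw3[of _ _ _ U, simplified, symmetric]) auto
    then show ?thesis by (simp add: insert_absorb)
  qed
  define D where "D x y = simplex_det x (u(j := y))" for x y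
  have nz: "D x y \<noteq> 0" if "x \<in> {p, q, r}" "y \<in> {p, q, r}" "x \<noteq> y" for x y
    using generic_simplex_det_nonzero[OF P _ bij[OF that(2)], of x] that U pqr by (auto simp: D_def)
  have sep: "separates (affine hull (insert z U)) x y \<longleftrightarrow> D x z * D y z < 0"
    if "x \<in> {p, q, r}" "y \<in> {p, q, r}" "z \<in> {p, q, r}" "x \<noteq> z" "y \<noteq> z" for x y z
    using separates_iff_det[OF bij[OF that(3)], of x y] nz[of x z] nz[of y z] that by (simp add: D_def)
  have anti: "D y x = - D x y" for x y unfolding D_def by (rule simplex_det_swap)
  have "D p q \<noteq> 0" "D p r \<noteq> 0" "D q r \<noteq> 0" using nz pqr by auto
  then show ?thesis
    using pqr by (simp add: sep anti[of p q] anti[of p r] anti[of q r] mult_less_0_iff zero_less_mult_iff)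
      linarith
qed

lemma card_Collect_sum_of_bool: "finite A \<Longrightarrow> card {x \<in> A. Q x} = (\<Sum>x\<in>A. of_bool (Q x))"
  by (simp add: of_bool_def sum.If_cases Int_def)

text \<open>The \<open>d\<close>-subsets that avoid \<open>p\<close> and \<open>q\<close> either avoid \<open>r\<close>, too, or arise from a \<open>(d - 1)\<close>-subset
  by adding \<open>r\<close>.\<close>

lemma num_separating_split:
  fixes P :: "(real ^ 'd) set"
  assumes P: "generic_config n P" and pqr: "r \<in> P" "p \<noteq> r" "q \<noteq> r"
  shows "num_separating P p q =
    (\<Sum>T | T \<subseteq> P - {p, q, r} \<and> card T = CARD('d). of_bool (separates (affine hull T) p q)) +
    (\<Sum>U | U \<subseteq> P - {p, q, r} \<and> card U = CARD('d) - 1.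
        of_bool (separates (affine hull (insert r U)) p q))"
proof -
  have fin: "finite P" using generic_configD(1)[OF P] .
  let ?T = "{T. T \<subseteq> P - {p, q, r} \<and> card T = CARD('d)}"
  let ?U = "{U. U \<subseteq> P - {p, q, r} \<and> card U = CARD('d) - 1}"
  let ?s = "\<lambda>T. of_bool (separates (affine hull T) p q) :: nat"
  have finU: "finite U" if "U \<subseteq> P - X" for U X using that fin finite_subset by blast
  have [simp]: "finite ?T" "finite ?U" using fin by (auto intro!: finite_subset[of _ "Pow P"])
  have inj: "inj_on (insert r) ?U" by (rule inj_onI) (auto dest: insert_ident[THEN iffD1, rotated 2])
  have "{T. T \<subseteq> P - {p, q} \<and> card T = CARD('d)} = ?T \<union> insert r ` ?U" (is "?L = ?R")
  proof (intro equalityI subsetI)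
    fix T assume T: "T \<in> ?L"
    show "T \<in> ?R"
    proof (cases "r \<in> T")
      case True
      then have "T = insert r (T - {r})" by auto
      moreover have "T - {r} \<in> ?U" using T True finU[of T] by (auto simp: card_Diff_singleton)
      ultimately show ?thesis by blast
    next
      case False
      then show ?thesis using T by auto
    qed
  next
    fix T assume "T \<in> ?R"
    then show "T \<in> ?L"
    proof
      assume "T \<in> insert r ` ?U"
      then obtain U where U: "T = insert r U" "U \<in> ?U" by auto
      moreover have "finite U" "r \<notin> U" using U finU[of U] by auto
      ultimately have "card T = CARD('d)" by simp
      then show ?thesis using U pqr by auto
    qed auto
  qed
  moreover have "num_separating P p q = (\<Sum>T\<in>?L. ?s T)"
    unfolding num_separating_eq[OF P] using fin
    by (subst card_Collect_sum_of_bool[symmetric]) (auto simp: conj_assoc)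
  moreover have "?T \<inter> insert r ` ?U = {}" by auto
  ultimately have "num_separating P p q = (\<Sum>T\<in>?T. ?s T) + (\<Sum>T\<in>insert r ` ?U. ?s T)"
    by (simp only: sum.union_disjoint[OF \<open>finite ?T\<close> finite_imageI[OF \<open>finite ?U\<close>]])
  then show ?thesis unfolding sum.reindex[OF inj] comp_def .
qed

text \<open>A \<open>d\<close>-subset that avoids \<open>p\<close>, \<open>q\<close>, \<open>r\<close> separates an even number of the three pairs, and each of
  the \<open>(d - 1)\<close>-subsets \<open>U\<close> of the remaining \<open>n - 3\<close> points contributes an odd number. This is where
  the binomial coefficient in the Orchard relation comes from.\<close>

lemma num_separating_triple:
  fixes P :: "(real ^ 'd) set"
  assumes P: "generic_config n P" and pqr: "p \<in> P" "q \<in> P" "r \<in> P" "p \<noteq> q" "p \<noteq> r" "q \<noteq> r"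
  shows "even (int (num_separating P p q + num_separating P q r + num_separating P p r)
           + int_binomial (int n - 3) (CARD('d) - 1))"
proof -
  have fin: "finite P" and n: "card P = n" using generic_configD[OF P] by auto
  let ?W = "P - {p, q, r}"
  let ?T = "{T. T \<subseteq> ?W \<and> card T = CARD('d)}"
  let ?U = "{U. U \<subseteq> ?W \<and> card U = CARD('d) - 1}"
  let ?s = "\<lambda>T p q. of_bool (separates (affine hull T) p q) :: nat"
  have c3: "card {p, q, r} = 3" using pqr by simp
  have "{p, q, r} \<subseteq> P" using pqr by simp
  then have "3 \<le> n" using card_mono[OF fin, of "{p, q, r}"] c3 n by simp
  have cW: "card ?W = n - 3"
    using card_Diff_subset[of "{p, q, r}" P] c3 n \<open>{p, q, r} \<subseteq> P\<close> by simp
  have [simp]: "finite ?T" "finite ?U" using fin by (auto intro!: finite_subset[of _ "Pow P"])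
  have eqW: "P - {q, r, p} = ?W" "P - {p, r, q} = ?W" by auto
  have num: "num_separating P p q + num_separating P q r + num_separating P p r =
      (\<Sum>T\<in>?T. ?s T p q + ?s T q r + ?s T p r) +
      (\<Sum>U\<in>?U. ?s (insert r U) p q + ?s (insert p U) q r + ?s (insert q U) p r)"
    using num_separating_split[OF P, of r p q] num_separating_split[OF P, of p q r]
      num_separating_split[OF P, of q p r] pqr unfolding eqW by (simp add: sum.distrib)
  have evT: "even (\<Sum>T\<in>?T. ?s T p q + ?s T q r + ?s T p r)"
    by (intro dvd_sum) (use separates_transitive_parity[OF P _ _ pqr(1-3)] in auto)
  have evU: "even ((\<Sum>U\<in>?U. ?s (insert r U) p q + ?s (insert p U) q r + ?s (insert q U) p r) + card ?U)"
  proof -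
    have "even (\<Sum>U\<in>?U. ?s (insert r U) p q + ?s (insert p U) q r + ?s (insert q U) p r + 1)"
      by (intro dvd_sum) (use separates_triangle_parity[OF P _ _ pqr] in auto)
    then show ?thesis unfolding sum.distrib[of _ "\<lambda>_. 1"] by simp
  qed
  have "int (card ?U) = int_binomial (int n - 3) (CARD('d) - 1)"
    using n_subsets[of ?W "CARD('d) - 1"] fin cW \<open>3 \<le> n\<close>
      int_binomial_of_nat[of "n - 3" "CARD('d) - 1"] by (simp add: of_nat_diff)
  moreover have "even (num_separating P p q + num_separating P q r + num_separating P p r + card ?U)"
    using dvd_add[OF evT evU] unfolding num by (simp only: add.assoc)
  then have "even (int (num_separating P p q + num_separating P q r + num_separating P p r) + int (card ?U))"
    by (simp only: even_of_nat flip: of_nat_add)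
  ultimately show ?thesis by (simp only:)
qed

lemma orchard_rel_iff:
  fixes P :: "(real ^ 'd) set"
  assumes "generic_config n P" "p \<in> P" "q \<in> P"
  shows "(p, q) \<in> orchard_rel P \<longleftrightarrow>
    p = q \<or> even (int (num_separating P p q) + int_binomial (int n - 3) (CARD('d) - 1))"
  using assms generic_configD(2)[OF assms(1)]
  by (auto simp: orchard_rel_def cong_def even_iff_mod_2_eq_zero[symmetric]) presburger+

text \<open>Transitivity, and at most two classes, in one statement.\<close>

lemma orchard_rel_triple:
  fixes P :: "(real ^ 'd) set"
  assumes P: "generic_config n P" and pqr: "p \<in> P" "q \<in> P" "r \<in> P"
  shows "(p, q) \<in> orchard_rel P \<longleftrightarrow> ((p, r) \<in> orchard_rel P \<longleftrightarrow> (q, r) \<in> orchard_rel P)"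
proof (cases "p = q \<or> p = r \<or> q = r")
  case True
  have "(x, x) \<in> orchard_rel P" if "x \<in> P" for x using that by (simp add: orchard_rel_iff[OF P])
  moreover have "(x, y) \<in> orchard_rel P \<longleftrightarrow> (y, x) \<in> orchard_rel P" if "x \<in> P" "y \<in> P" for x y
    using that by (auto simp: orchard_rel_iff[OF P] num_separating_commute[of P x y])
  ultimately show ?thesis using True pqr by metis
next
  case False
  then have "p \<noteq> q" "p \<noteq> r" "q \<noteq> r" by auto
  then show ?thesis using num_separating_triple[OF P pqr] pqr
    by (simp add: orchard_rel_iff[OF P]) blast
qed

text \<open>The possible selected classes are the sets \<open>S\<close> such that equivalence means lying on the same side
  of the partition into \<open>S\<close> and \<open>P - S\<close>. This covers the empty class as well.\<close>

lemma orchard_classes_eq: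
  fixes P :: "(real ^ 'd) set"
  assumes P: "generic_config n P" and ne: "P \<noteq> {}"
  shows "orchard_classes P =
    {S. S \<subseteq> P \<and> (\<forall>p\<in>P. \<forall>q\<in>P. (p, q) \<in> orchard_rel P \<longleftrightarrow> (p \<in> S \<longleftrightarrow> q \<in> S))}"
    (is "_ = {S. ?C S}")
proof -
  let ?R = "orchard_rel P"
  have refl: "(p, p) \<in> ?R" if "p \<in> P" for p using that by (simp add: orchard_rel_def)
  note triple = orchard_rel_triple[OF P]
  have sub: "?R `` {p} \<subseteq> P" for p by (auto simp: orchard_rel_def)
  have cls: "?C (?R `` {p})" if "p \<in> P" for p
  proof (intro conjI sub ballI)
    fix q r assume "q \<in> P" "r \<in> P"
    then show "(q, r) \<in> ?R \<longleftrightarrow> (q \<in> ?R `` {p} \<longleftrightarrow> r \<in> ?R `` {p})"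
      using triple[OF _ _ that, of q r] triple[OF that _ _, of q q] triple[OF that _ _, of r r] refl
        triple[OF _ that, of q q] triple[OF _ that, of r r]
      by (simp add: Image_singleton_iff)
  qed
  have one: "card (P // ?R) = 1 \<longleftrightarrow> (\<forall>p\<in>P. \<forall>q\<in>P. (p, q) \<in> ?R)"
  proof
    assume "card (P // ?R) = 1"
    then obtain X where "P // ?R = {X}" by (auto simp: card_1_singleton_iff)
    then have "?R `` {p} = X" if "p \<in> P" for p using that by (auto simp: quotient_def)
    then show "\<forall>p\<in>P. \<forall>q\<in>P. (p, q) \<in> ?R" using refl by blast
  next
    assume all: "\<forall>p\<in>P. \<forall>q\<in>P. (p, q) \<in> ?R"
    have "?R `` {p} = P" if "p \<in> P" for p
      using sub[of p] all that by blast
    then have "P // ?R = {P}" using ne by (auto simp: quotient_def)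
    then show "card (P // ?R) = 1" by simp
  qed
  show ?thesis
  proof (intro equalityI subsetI)
    fix S assume "S \<in> orchard_classes P"
    then have "S \<in> P // ?R \<or> S = {} \<and> card (P // ?R) = 1"
      unfolding orchard_classes_def by (cases "card (P // ?R) = 1") auto
    then consider "S \<in> P // ?R" | "S = {}" "card (P // ?R) = 1"
      by blast
    then show "S \<in> {S. ?C S}"
    proof cases
      case 1
      then obtain p where p: "p \<in> P" "S = ?R `` {p}" by (auto elim: quotientE)
      show ?thesis unfolding p(2) by (rule CollectI, rule cls[OF p(1)])
    next
      case 2
      have "\<forall>p\<in>P. \<forall>q\<in>P. (p, q) \<in> ?R" using one 2(2) by blast
      then show ?thesis using 2(1) by blast
    qed
  next
    fix S assume "S \<in> {S. ?C S}"
    then have SP: "S \<subseteq> P" by simp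
    have S: "(p, q) \<in> ?R \<longleftrightarrow> (p \<in> S \<longleftrightarrow> q \<in> S)" if "p \<in> P" "q \<in> P" for p q
      using \<open>S \<in> {S. ?C S}\<close> that by blast
    show "S \<in> orchard_classes P"
    proof (cases "S = {}")
      case True
      then have "\<forall>p\<in>P. \<forall>q\<in>P. (p, q) \<in> ?R" using S by blast
      then have "card (P // ?R) = 1" using one by blast
      then show ?thesis using True by (simp add: orchard_classes_def)
    next
      case False
      then obtain p where "p \<in> S" by auto
      then have p: "p \<in> P" using SP by auto
      have "q \<in> ?R `` {p} \<longleftrightarrow> q \<in> S" for q
        using S[OF p, of q] \<open>p \<in> S\<close> SP sub[of p] by blast
      then have "S = ?R `` {p}" by blast
      then have "S \<in> P // ?R" using p by (auto intro: quotientI)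
      then show ?thesis by (simp add: orchard_classes_def)
    qed
  qed
qed

lemma orchard_classes_complement:
  fixes P :: "(real ^ 'd) set"
  assumes "generic_config n P" "P \<noteq> {}" "S \<in> orchard_classes P"
  shows "P - S \<in> orchard_classes P"
  using assms(3) unfolding orchard_classes_eq[OF assms(1,2)] by blast

lemma orchard_classes_unique:
  fixes P :: "(real ^ 'd) set"
  assumes P: "generic_config n P" "P \<noteq> {}" and S: "S \<in> orchard_classes P" "S' \<in> orchard_classes P"
  shows "S' = S \<or> S' = P - S"
proof -
  obtain p where "p \<in> P" using P(2) by auto
  have "S \<subseteq> P" "S' \<subseteq> P" "\<And>q. q \<in> P \<Longrightarrow> (p \<in> S \<longleftrightarrow> q \<in> S) \<longleftrightarrow> (p \<in> S' \<longleftrightarrow> q \<in> S')"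
    using S \<open>p \<in> P\<close> unfolding orchard_classes_eq[OF P] by blast+
  then show ?thesis by (cases "p \<in> S \<longleftrightarrow> p \<in> S'") blast+
qed

lemma orchard_classes_nonempty:
  fixes P :: "(real ^ 'd) set"
  assumes "P \<noteq> {}"
  shows "orchard_classes P \<noteq> {}"
  using assms by (auto simp: orchard_classes_def quotient_def)

section \<open>The effect of reversing one orientation\<close>

lemma num_separating_indexed:
  fixes c :: "'i \<Rightarrow> real ^ 'd"
  assumes P: "generic_config n (c ` N)" and inj: "inj_on c N" and ij: "i \<in> N" "j \<in> N"
  shows "num_separating (c ` N) (c i) (c j) =
    card {T. T \<subseteq> N - {i, j} \<and> card T = CARD('d) \<and> separates (affine hull (c ` T)) (c i) (c j)}"
proof -
  have inj': "inj_on c (N - {i, j})" using inj by (rule inj_on_subset) auto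
  have im: "c ` N - {c i, c j} = c ` (N - {i, j})" using inj ij by (auto simp: inj_on_def)
  have card: "card (c ` T) = card T" if "T \<subseteq> N - {i, j}" for T
    using inj' that by (intro card_image) (rule inj_on_subset)
  have "{T. T \<subseteq> c ` (N - {i, j}) \<and> card T = CARD('d) \<and> separates (affine hull T) (c i) (c j)} =
    (`) c ` {T. T \<subseteq> N - {i, j} \<and> card T = CARD('d) \<and> separates (affine hull (c ` T)) (c i) (c j)}"
    (is "_ = _ ` ?S")
  proof (intro equalityI subsetI)
    fix T assume T: "T \<in> {T. T \<subseteq> c ` (N - {i, j}) \<and> card T = CARD('d) \<and> separates (affine hull T) (c i) (c j)}"
    then obtain T' where T': "T' \<subseteq> N - {i, j}" "T = c ` T'" by (auto simp: subset_image_iff)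
    then have "T' \<in> ?S" using T card[of T'] by simp
    then show "T \<in> (`) c ` ?S" using T'(2) by blast
  next
    fix T assume "T \<in> (`) c ` ?S"
    then obtain T' where T': "T' \<in> ?S" "T = c ` T'" by (rule imageE)
    then have "T' \<subseteq> N - {i, j}" by simp
    then show "T \<in> {T. T \<subseteq> c ` (N - {i, j}) \<and> card T = CARD('d) \<and> separates (affine hull T) (c i) (c j)}"
      using T' card[of T'] image_mono[of T' "N - {i, j}" c] by simp
  qed
  moreover have "inj_on ((`) c) ?S"
    by (rule inj_on_subset[OF inj_on_image_Pow[OF inj']]) auto
  ultimately show ?thesis unfolding num_separating_eq[OF P] im by (simp add: card_image)
qed

text \<open>Two families indexed by \<open>N\<close> induce the same orientation on all \<open>(d + 1)\<close>-subsets of \<open>N\<close>, except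
  on \<open>I\<close>, where the orientations are opposite. For \<open>I = {}\<close> there is no exception.\<close>

definition same_orientations_except ::
    "'i set \<Rightarrow> 'i set \<Rightarrow> ('i \<Rightarrow> real ^ 'd) \<Rightarrow> ('i \<Rightarrow> real ^ 'd) \<Rightarrow> bool" where
  "same_orientations_except N I c c' \<longleftrightarrow>
     (\<forall>i\<in>N. \<forall>e :: 'd \<Rightarrow> 'i. inj e \<longrightarrow> range e \<subseteq> N - {i} \<longrightarrow>
        orientation (c' i) (c' \<circ> e) =
          (if insert i (range e) = I then - orientation (c i) (c \<circ> e)
           else orientation (c i) (c \<circ> e)))"

lemma separates_orientation_change:
  fixes c c' :: "'i \<Rightarrow> real ^ 'd"
  assumes gen: "generic_config n (c ` N)" "inj_on c N" "generic_config n (c' ` N)" "inj_on c' N"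
    and same: "same_orientations_except N I c c'"
    and T: "T \<subseteq> N - {i, j}" "card T = CARD('d)" and ij: "i \<in> N" "j \<in> N"
  shows "separates (affine hull (c' ` T)) (c' i) (c' j) \<longleftrightarrow>
    (separates (affine hull (c ` T)) (c i) (c j) \<longleftrightarrow> (insert i T = I \<longleftrightarrow> insert j T = I))"
proof -
  obtain e :: "'d \<Rightarrow> 'i" where e: "bij_betw e UNIV T" using ex_enumeration[OF T(2)] .
  then have ran: "range e = T" and inje: "inj e" by (auto simp: bij_betw_def)
  have sep: "separates (affine hull (b ` T)) (b i) (b j) \<longleftrightarrow>
      orientation (b i) (b \<circ> e) * orientation (b j) (b \<circ> e) < 0 \<and> orientation (b i) (b \<circ> e) \<noteq> 0
        \<and> orientation (b j) (b \<circ> e) \<noteq> 0"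
    and nz: "orientation (b i) (b \<circ> e) \<noteq> 0" "orientation (b j) (b \<circ> e) \<noteq> 0"
    if b: "generic_config n (b ` N)" "inj_on b N" for b :: "'i \<Rightarrow> real ^ 'd"
  proof -
    have inj: "inj_on b T" using b(2) by (rule inj_on_subset) (use T in auto)
    have be: "bij_betw (b \<circ> e) UNIV (b ` T)"
      by (rule bij_betw_trans[OF e inj_on_imp_bij_betw[OF inj]])
    have 1: "b ` T \<subseteq> b ` N - {b i}" "b ` T \<subseteq> b ` N - {b j}" using T ij b(2) by (auto simp: inj_on_def)
    have 2: "simplex_det (b i) (b \<circ> e) \<noteq> 0" "simplex_det (b j) (b \<circ> e) \<noteq> 0"
      using generic_simplex_det_nonzero[OF b(1) _ be] ij 1 by auto
    then show nz: "orientation (b i) (b \<circ> e) \<noteq> 0" "orientation (b j) (b \<circ> e) \<noteq> 0"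
      by (simp_all add: orientation_eq_sgn sgn_zero_iff)
    show "separates (affine hull (b ` T)) (b i) (b j) \<longleftrightarrow>
      orientation (b i) (b \<circ> e) * orientation (b j) (b \<circ> e) < 0 \<and> orientation (b i) (b \<circ> e) \<noteq> 0
        \<and> orientation (b j) (b \<circ> e) \<noteq> 0"
      unfolding separates_iff_det[OF be 2] using nz
      by (simp add: orientation_eq_sgn flip: sgn_mult)
  qed
  have s: "orientation (c' k) (c' \<circ> e) = (if insert k T = I then - orientation (c k) (c \<circ> e)
           else orientation (c k) (c \<circ> e))" if "k \<in> {i, j}" for k
  proof -
    have "k \<in> N" "range e \<subseteq> N - {k}" using that ij T ran by auto
    then show ?thesis
      using same inje unfolding same_orientations_except_def ran[symmetric] by blast
  qed
  have si: "orientation (c' i) (c' \<circ> e) = (if insert i T = I then - orientation (c i) (c \<circ> e)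
           else orientation (c i) (c \<circ> e))"
   and sj: "orientation (c' j) (c' \<circ> e) = (if insert j T = I then - orientation (c j) (c \<circ> e)
           else orientation (c j) (c \<circ> e))"
    using s[of i] s[of j] by auto
  show ?thesis
    unfolding sep[OF gen(1,2)] sep[OF gen(3,4)] si sj
    using nz[OF gen(1,2)] by (auto simp: mult_less_0_iff)
qed

lemma even_card_exclusive_or:
  assumes "finite A" "\<And>x. x \<in> A \<Longrightarrow> Q' x \<longleftrightarrow> (Q x \<longleftrightarrow> \<not> R x)"
  shows "even (card {x \<in> A. Q' x} + card {x \<in> A. Q x} + card {x \<in> A. R x})"
proof -
  have "card {x \<in> A. Q' x} + card {x \<in> A. Q x} + card {x \<in> A. R x} =
      (\<Sum>x\<in>A. of_bool (Q' x) + of_bool (Q x) + of_bool (R x))"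
    using assms(1) by (simp only: card_Collect_sum_of_bool sum.distrib)
  also have "even \<dots>" using assms(2) by (intro dvd_sum) auto
  finally show ?thesis .
qed

text \<open>The hyperplane spanned by \<open>T\<close> changes its contribution to \<open>n(i, j)\<close> when exactly one of
  \<open>T \<union> {i}\<close> and \<open>T \<union> {j}\<close> is \<open>I\<close>. There is such a \<open>T\<close> avoiding \<open>i\<close> and \<open>j\<close>, and then only one, if and only if
  exactly one of \<open>i\<close>, \<open>j\<close> belongs to \<open>I\<close>.\<close>

lemma num_separating_orientation_change:
  fixes c c' :: "'i \<Rightarrow> real ^ 'd"
  assumes gen: "generic_config n (c ` N)" "inj_on c N" "generic_config n (c' ` N)" "inj_on c' N"
    and same: "same_orientations_except N I c c'"
    and I: "I = {} \<or> I \<subseteq> N \<and> card I = CARD('d) + 1"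
    and ij: "i \<in> N" "j \<in> N" "i \<noteq> j"
  shows "even (num_separating (c' ` N) (c' i) (c' j) + num_separating (c ` N) (c i) (c j)
    + of_bool (i \<in> I \<longleftrightarrow> j \<notin> I))"
proof -
  have finN: "finite N" using finite_imageD[OF generic_configD(1)[OF gen(1)] gen(2)] .
  let ?A = "{T. T \<subseteq> N - {i, j} \<and> card T = CARD('d)}"
  have finA: "finite ?A" using finN by (auto intro!: finite_subset[of _ "Pow N"])
  have split: "{T \<in> ?A. insert i T = I \<longleftrightarrow> insert j T \<noteq> I} =
    (if i \<in> I \<and> j \<notin> I then {I - {i}} else if j \<in> I \<and> i \<notin> I then {I - {j}} else {})"
    using I ij by (auto simp: card_Diff_singleton)
  have "card {T \<in> ?A. insert i T = I \<longleftrightarrow> insert j T \<noteq> I} = of_bool (i \<in> I \<longleftrightarrow> j \<notin> I)"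
    unfolding split by (cases "i \<in> I"; cases "j \<in> I") simp_all
  moreover have "even (card {T \<in> ?A. separates (affine hull (c' ` T)) (c' i) (c' j)} +
     card {T \<in> ?A. separates (affine hull (c ` T)) (c i) (c j)} +
     card {T \<in> ?A. insert i T = I \<longleftrightarrow> insert j T \<noteq> I})"
    by (rule even_card_exclusive_or[OF finA]) (use separates_orientation_change[OF gen same _ _ ij(1,2)] in auto)
  ultimately show ?thesis
    unfolding num_separating_indexed[OF gen(1,2) ij(1,2)] num_separating_indexed[OF gen(3,4) ij(1,2)]
    by (simp add: conj_assoc)
qed

text \<open>A flip moves the points of its flipset to the other Orchard class; for \<open>I = {}\<close>, isomorphisms
  respect Orchard classes.\<close>

lemma orchard_classes_orientation_change:
  fixes c c' :: "'i \<Rightarrow> real ^ 'd"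
  assumes gen: "generic_config n (c ` N)" "inj_on c N" "generic_config n (c' ` N)" "inj_on c' N"
    and same: "same_orientations_except N I c c'"
    and I: "I = {} \<or> I \<subseteq> N \<and> card I = CARD('d) + 1"
    and A: "A \<subseteq> N" "c ` A \<in> orchard_classes (c ` N)" and ne: "N \<noteq> {}"
  shows "c' ` (sym_diff A I) \<in> orchard_classes (c' ` N)"
proof -
  have ne': "c ` N \<noteq> {}" "c' ` N \<noteq> {}" using ne by auto
  let ?B = "sym_diff A I"
  have B: "?B \<subseteq> N" using A I by auto
  have memA: "c i \<in> c ` A \<longleftrightarrow> i \<in> A" if "i \<in> N" for i
    using that A(1) gen(2) by (auto simp: inj_on_def)
  have memB: "c' i \<in> c' ` ?B \<longleftrightarrow> i \<in> ?B" if "i \<in> N" for i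
    using inj_on_image_mem_iff[OF gen(4) that B] .
  have A': "(c i, c j) \<in> orchard_rel (c ` N) \<longleftrightarrow> (i \<in> A \<longleftrightarrow> j \<in> A)" if "i \<in> N" "j \<in> N" for i j
    using A(2) that memA unfolding orchard_classes_eq[OF gen(1) ne'(1)] by blast
  have "(c' i, c' j) \<in> orchard_rel (c' ` N) \<longleftrightarrow> (i \<in> ?B \<longleftrightarrow> j \<in> ?B)" if "i \<in> N" "j \<in> N" for i j
  proof (cases "i = j")
    case True
    then show ?thesis using that by (simp add: orchard_rel_def)
  next
    case False
    then have "c i \<noteq> c j" "c' i \<noteq> c' j" using that gen by (auto simp: inj_on_def)
    then have "(c' i, c' j) \<in> orchard_rel (c' ` N) \<longleftrightarrow>
       ((c i, c j) \<in> orchard_rel (c ` N) \<longleftrightarrow> \<not> (i \<in> I \<longleftrightarrow> j \<notin> I))"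
      using num_separating_orientation_change[OF gen same I that False] that
      by (cases "i \<in> I"; cases "j \<in> I")
        (auto simp: orchard_rel_iff[OF gen(1)] orchard_rel_iff[OF gen(3)])
    then show ?thesis using A'[OF that] by blast
  qed
  then show ?thesis
    unfolding orchard_classes_eq[OF gen(3) ne'(2)] using memB B by auto
qed

section \<open>The parity of the classes for even n and odd d\<close>

lemma card_split_pairs:
  fixes N :: "'a::linorder set"
  assumes "finite N" "A \<subseteq> N"
  shows "card {(i, j). i \<in> N \<and> j \<in> N \<and> i < j \<and> (i \<in> A \<longleftrightarrow> j \<notin> A)} = card A * card (N - A)"
proof -
  let ?S = "{(i, j). i \<in> N \<and> j \<in> N \<and> i < j \<and> (i \<in> A \<longleftrightarrow> j \<notin> A)}"
  have "bij_betw (\<lambda>(i, j). if i < j then (i, j) else (j, i)) (A \<times> (N - A)) ?S"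
  proof (rule bij_betw_byWitness[where f' = "\<lambda>(i, j). if i \<in> A then (i, j) else (j, i)"])
    show "(\<lambda>(i, j). if i < j then (i, j) else (j, i)) ` (A \<times> (N - A)) \<subseteq> ?S"
    proof (intro image_subsetI)
      fix x assume "x \<in> A \<times> (N - A)"
      then obtain i j where x: "x = (i, j)" "i \<in> A" "j \<in> N" "j \<notin> A" by auto
      then have "i < j \<or> j < i" by (metis neqE)
      then show "(case x of (i, j) \<Rightarrow> if i < j then (i, j) else (j, i)) \<in> ?S"
        using x assms(2) by (cases "i < j") auto
    qed
  qed (use assms(2) in auto)
  from bij_betw_same_card[OF this] show ?thesis by (simp add: card_cartesian_product)
qed

text \<open>A hyperplane through \<open>d\<close> of the points leaves \<open>l\<close> points on one side and \<open>r\<close> points on the other and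
  is counted for \<open>l r\<close> pairs. As \<open>l + r = n - d\<close> is odd, \<open>l r\<close> is even.\<close>

lemma even_sum_num_separating:
  fixes c :: "'i::linorder \<Rightarrow> real ^ 'd"
  assumes P: "generic_config n (c ` N)" and inj: "inj_on c N" and par: "even n" "odd CARD('d)"
  shows "even (\<Sum>(i, j) | i \<in> N \<and> j \<in> N \<and> i < j. num_separating (c ` N) (c i) (c j))"
proof -
  have fin: "finite N" using finite_imageD[OF generic_configD(1)[OF P] inj] .
  have n: "card N = n" using generic_configD(2)[OF P] card_image[OF inj] by simp
  define E where "E = {(i, j). i \<in> N \<and> j \<in> N \<and> i < j}"
  have finE: "finite E" by (rule finite_subset[of _ "N \<times> N"]) (auto simp: E_def fin)
  define TT where "TT = {T. T \<subseteq> N \<and> card T = CARD('d)}"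
  have finT: "finite TT" using fin by (auto simp: TT_def)
  define Q where "Q T x \<longleftrightarrow> fst x \<notin> T \<and> snd x \<notin> T \<and>
      separates (affine hull (c ` T)) (c (fst x)) (c (snd x))" for T and x :: "'i \<times> 'i"
  have "(\<Sum>(i, j)\<in>E. num_separating (c ` N) (c i) (c j)) = (\<Sum>x\<in>E. card {T \<in> TT. Q T x})"
  proof (rule sum.cong[OF refl])
    fix x assume "x \<in> E"
    then obtain i j where x: "x = (i, j)" "i \<in> N" "j \<in> N" by (auto simp: E_def)
    have "{T. T \<subseteq> N - {i, j} \<and> card T = CARD('d) \<and> separates (affine hull (c ` T)) (c i) (c j)} =
        {T \<in> TT. Q T x}"
      by (auto simp: TT_def Q_def x)
    then show "(case x of (i, j) \<Rightarrow> num_separating (c ` N) (c i) (c j)) = card {T \<in> TT. Q T x}"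
      using num_separating_indexed[OF P inj x(2,3)] by (simp add: x)
  qed
  also have "\<dots> = (\<Sum>T\<in>TT. card {x \<in> E. Q T x})"
    unfolding card_Collect_sum_of_bool[OF finT] card_Collect_sum_of_bool[OF finE] by (rule sum.swap)
  also have "even \<dots>"
  proof (rule dvd_sum)
    fix T assume "T \<in> TT"
    then have T: "T \<subseteq> N" "card T = CARD('d)" by (auto simp: TT_def)
    obtain e :: "'d \<Rightarrow> 'i" where e: "bij_betw e UNIV T" using ex_enumeration[OF T(2)] .
    have be: "bij_betw (c \<circ> e) UNIV (c ` T)"
      by (rule bij_betw_trans[OF e inj_on_imp_bij_betw[OF inj_on_subset[OF inj T(1)]]])
    have nz: "simplex_det (c i) (c \<circ> e) \<noteq> 0" if "i \<in> N - T" for i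
      using generic_simplex_det_nonzero[OF P _ be, of "c i"] that T(1) inj by (auto simp: inj_on_def)
    define A where "A = {i \<in> N - T. simplex_det (c i) (c \<circ> e) > 0}"
    have "Q T (i, j) \<longleftrightarrow> i \<in> N - T \<and> j \<in> N - T \<and> (i \<in> A \<longleftrightarrow> j \<notin> A)" if "i \<in> N" "j \<in> N" for i j
    proof (cases "i \<in> T \<or> j \<in> T")
      case True
      then show ?thesis by (auto simp: Q_def)
    next
      case False
      then have "separates (affine hull (c ` T)) (c i) (c j) \<longleftrightarrow> (i \<in> A \<longleftrightarrow> j \<notin> A)"
        using separates_iff_det[OF be nz[of i] nz[of j]] nz[of i] nz[of j] that
        by (auto simp: A_def mult_less_0_iff)
      then show ?thesis using False that by (simp add: Q_def)
    qed
    then have "{x \<in> E. Q T x} = {(i, j). i \<in> N - T \<and> j \<in> N - T \<and> i < j \<and> (i \<in> A \<longleftrightarrow> j \<notin> A)}"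
      unfolding E_def by blast
    moreover have AN: "A \<subseteq> N - T" by (auto simp: A_def)
    ultimately have "card {x \<in> E. Q T x} = card A * card (N - T - A)"
      using card_split_pairs[OF _ AN] fin by simp
    moreover have "card A + card (N - T - A) = n - CARD('d)"
    proof -
      have "card (N - T) = n - CARD('d)"
        using card_Diff_subset[OF finite_subset[OF T(1) fin] T(1)] n T(2) by simp
      moreover have "card (N - T) = card A + card (N - T - A)"
        using fin AN card_mono[of "N - T" A] by (simp add: card_Diff_subset finite_subset[OF AN])
      ultimately show ?thesis by simp
    qed
    moreover have "odd (n - CARD('d))"
      using par card_mono[OF fin T(1)] n T(2) by simp
    ultimately show "even (card {x \<in> E. Q T x})" by (metis even_add even_mult_iff)
  qed
  finally show ?thesis by (simp add: E_def)
qed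

text \<open>The number of inequivalent pairs is \<open>a b\<close>. Modulo 2 it is the sum of all \<open>n(P, Q)\<close>, which is even,
  plus a binomial coefficient for each pair. As \<open>a + b = n\<close> is even, \<open>a b\<close> and \<open>a\<close> have the same parity.\<close>

lemma card_orchard_class_parity:
  fixes P :: "(real ^ 'd) set"
  assumes P: "generic_config n P" and n: "n \<ge> 1" and par: "even n" "odd CARD('d)"
    and S: "S \<in> orchard_classes P"
  shows "even (int (card S)
    + int_binomial (int n - 3) (CARD('d) - 1) * int (card {(i, j). i \<in> {1..n} \<and> j \<in> {1..n} \<and> i < j}))"
proof -
  let ?N = "{1..n}"
  define K where "K = int_binomial (int n - 3) (CARD('d) - 1)"
  define E where "E = {(i, j). i \<in> ?N \<and> j \<in> ?N \<and> i < j}"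
  have finE: "finite E" by (rule finite_subset[of _ "?N \<times> ?N"]) (auto simp: E_def)
  obtain c where c: "bij_betw c ?N P"
    using ex_bij_betw_nat_finite_1[of P] generic_configD[OF P] by auto
  then have inj: "inj_on c ?N" and im: "c ` ?N = P" by (auto simp: bij_betw_def)
  have ne: "P \<noteq> {}" using n generic_configD(2)[OF P] by auto
  have SP: "S \<subseteq> P" using S unfolding orchard_classes_eq[OF P ne] by simp
  define A where "A = {i \<in> ?N. c i \<in> S}"
  have "c ` A = S" using SP im by (auto simp: A_def)
  then have cA: "card A = card S" using inj by (metis (no_types, lifting) A_def card_image inj_on_subset mem_Collect_eq subsetI)
  have rel: "(c i, c j) \<in> orchard_rel P \<longleftrightarrow> (i \<in> A \<longleftrightarrow> j \<in> A)" if "i \<in> ?N" "j \<in> ?N" for i j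
  proof -
    have "c i \<in> P" "c j \<in> P" using that im by auto
    then have "(c i, c j) \<in> orchard_rel P \<longleftrightarrow> (c i \<in> S \<longleftrightarrow> c j \<in> S)"
      using S unfolding orchard_classes_eq[OF P ne] by blast
    then show ?thesis using that by (simp add: A_def)
  qed
  have num: "even (of_bool (i \<in> A \<longleftrightarrow> j \<notin> A) + int (num_separating P (c i) (c j)) + K)"
    if "(i, j) \<in> E" for i j
  proof -
    have ij: "i \<in> ?N" "j \<in> ?N" "i \<noteq> j" using that by (auto simp: E_def)
    then have "c i \<noteq> c j" "c i \<in> P" "c j \<in> P" using im inj_onD[OF inj] by blast+
    then show ?thesis using rel[OF ij(1,2)] orchard_rel_iff[OF P, of "c i" "c j"]
      by (cases "i \<in> A"; cases "j \<in> A") (auto simp: K_def)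
  qed
  define X where "X = (\<Sum>(i, j)\<in>E. of_bool (i \<in> A \<longleftrightarrow> j \<notin> A) :: nat)"
  define Y where "Y = (\<Sum>(i, j)\<in>E. num_separating P (c i) (c j))"
  have "even (\<Sum>(i, j)\<in>E. of_bool (i \<in> A \<longleftrightarrow> j \<notin> A) + int (num_separating P (c i) (c j)) + K)"
    by (rule dvd_sum) (use num in auto)
  also have "(\<Sum>(i, j)\<in>E. of_bool (i \<in> A \<longleftrightarrow> j \<notin> A) + int (num_separating P (c i) (c j)) + K) =
      int X + int Y + int (card E) * K"
    by (simp add: X_def Y_def case_prod_unfold sum.distrib)
  finally have "even (int X + int Y + int (card E) * K)" .
  moreover have "X = card A * card (?N - A)"
  proof -
    have seteq: "{x \<in> E. fst x \<in> A \<longleftrightarrow> snd x \<notin> A} =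
      {(i, j). i \<in> ?N \<and> j \<in> ?N \<and> i < j \<and> (i \<in> A \<longleftrightarrow> j \<notin> A)}"
      unfolding E_def by auto
    have "X = card {x \<in> E. fst x \<in> A \<longleftrightarrow> snd x \<notin> A}"
      unfolding X_def case_prod_unfold by (rule card_Collect_sum_of_bool[OF finE, symmetric])
    also have "\<dots> = card A * card (?N - A)"
      unfolding seteq by (rule card_split_pairs) (auto simp: A_def)
    finally show ?thesis .
  qed
  moreover have "even (card A * card (?N - A)) \<longleftrightarrow> even (card A)"
  proof -
    have "card A + card (?N - A) = n"
    proof -
      have "A \<subseteq> ?N" by (auto simp: A_def)
      then show ?thesis
        using card_Diff_subset[of A ?N] card_mono[of ?N A] finite_subset[of A ?N] by simp
    qed
    then show ?thesis using par(1) by (metis even_add even_mult_iff)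
  qed
  moreover have "even Y"
    using even_sum_num_separating[of n c ?N] P inj par unfolding Y_def im E_def by simp
  ultimately have "even (int (card A) + K * int (card E))"
    by (auto simp: mult.commute)
  then show ?thesis by (simp add: cA K_def E_def)
qed

section \<open>The flip graph and parity\<close>

lemma pconfigsD:
  assumes "(P, S) \<in> pconfigs n" and "n \<ge> 1"
  shows "generic_config n P" "P \<noteq> {}" "S \<in> orchard_classes P" "S \<subseteq> P" "finite S"
proof -
  show P: "generic_config n P" and S: "S \<in> orchard_classes P" using assms by (auto simp: pconfigs_def)
  show ne: "P \<noteq> {}" using generic_configD(2)[OF P] assms(2) by auto
  show "S \<subseteq> P" using S unfolding orchard_classes_eq[OF P ne] by simp
  then show "finite S" using generic_configD(1)[OF P] finite_subset by blast
qed

lemma config_iso_inverse: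
  fixes P P' :: "(real ^ 'd) set"
  assumes "config_iso \<phi> P P'"
  shows "config_iso (inv_into P \<phi>) P' P"
proof -
  have bij: "bij_betw \<phi> P P'" using assms by (simp add: config_iso_def)
  have f: "\<phi> (inv_into P \<phi> x) = x" "inv_into P \<phi> x \<in> P" if "x \<in> P'" for x
    using bij that by (auto simp: bij_betw_inv_into_right inv_into_into bij_betw_def)
  show ?thesis unfolding config_iso_def
  proof (intro conjI ballI allI impI)
    show "bij_betw (inv_into P \<phi>) P' P" using bij by (rule bij_betw_inv_into)
    fix p :: "real ^ 'd" and q :: "'d \<Rightarrow> real ^ 'd" assume p: "p \<in> P'" and q: "range q \<subseteq> P'"
    have "range (inv_into P \<phi> \<circ> q) \<subseteq> P" using q f(2) by auto
    then have "orientation (\<phi> (inv_into P \<phi> p)) (\<phi> \<circ> (inv_into P \<phi> \<circ> q)) =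
        orientation (inv_into P \<phi> p) (inv_into P \<phi> \<circ> q)"
      using assms f(2)[OF p] unfolding config_iso_def by blast
    moreover have "\<phi> \<circ> (inv_into P \<phi> \<circ> q) = q" using q f(1) by (auto simp: fun_eq_iff)
    ultimately show "orientation (inv_into P \<phi> p) (inv_into P \<phi> \<circ> q) = orientation p q"
      by (simp add: f(1)[OF p])
  qed
qed

lemma config_iso_comp:
  fixes P P' P'' :: "(real ^ 'd) set"
  assumes "config_iso \<phi> P P'" "config_iso \<psi> P' P''"
  shows "config_iso (\<psi> \<circ> \<phi>) P P''"
proof -
  have mem: "\<phi> x \<in> P'" if "x \<in> P" for x using assms(1) that by (auto simp: config_iso_def bij_betw_def)
  show ?thesis unfolding config_iso_def
  proof (intro conjI ballI allI impI)
    show "bij_betw (\<psi> \<circ> \<phi>) P P''" using assms by (auto simp: config_iso_def intro: bij_betw_trans)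
    fix p :: "real ^ 'd" and q :: "'d \<Rightarrow> real ^ 'd" assume p: "p \<in> P" and q: "range q \<subseteq> P"
    have "range (\<phi> \<circ> q) \<subseteq> P'" using q mem by auto
    then have "orientation (\<psi> (\<phi> p)) (\<psi> \<circ> (\<phi> \<circ> q)) = orientation (\<phi> p) (\<phi> \<circ> q)"
      using assms(2) mem[OF p] unfolding config_iso_def by blast
    then show "orientation ((\<psi> \<circ> \<phi>) p) ((\<psi> \<circ> \<phi>) \<circ> q) = orientation p q"
      using assms(1) p q by (simp add: config_iso_def o_assoc)
  qed
qed

lemma equiv_pconfig_iso_rel:
  assumes "n \<ge> 1"
  shows "equiv (pconfigs n) (pconfig_iso_rel n :: ('d::finite pconfig \<times> 'd pconfig) set)"
proof (rule equivI)
  show "pconfig_iso_rel n \<subseteq> (pconfigs n :: 'd pconfig set) \<times> pconfigs n"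
    by (auto simp: pconfig_iso_rel_def)
  have "config_iso id P P" for P :: "(real ^ 'd) set" by (simp add: config_iso_def)
  then show "refl_on (pconfigs n :: 'd pconfig set) (pconfig_iso_rel n)"
    by (auto simp: refl_on_def pconfig_iso_rel_def intro!: exI[of _ id])
  show "sym (pconfig_iso_rel n :: ('d pconfig \<times> 'd pconfig) set)"
  proof (rule symI)
    fix x y :: "'d pconfig" assume "(x, y) \<in> pconfig_iso_rel n"
    then obtain P S P' S' \<phi> where xy: "x = (P, S)" "y = (P', S')" "x \<in> pconfigs n" "y \<in> pconfigs n"
      "config_iso \<phi> P P'" "\<phi> ` S = S'" by (auto simp: pconfig_iso_rel_def)
    have "S \<subseteq> P" using pconfigsD[OF _ assms] xy by blast
    then have "inv_into P \<phi> ` S' = S"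
      using xy(5,6) inv_into_image_cancel[of \<phi> P S] by (auto simp: config_iso_def bij_betw_def)
    then show "(y, x) \<in> pconfig_iso_rel n"
      using xy config_iso_inverse[OF xy(5)] by (auto simp: pconfig_iso_rel_def)
  qed
  show "trans (pconfig_iso_rel n :: ('d pconfig \<times> 'd pconfig) set)"
  proof (rule transI)
    fix x y z :: "'d pconfig" assume "(x, y) \<in> pconfig_iso_rel n" "(y, z) \<in> pconfig_iso_rel n"
    then obtain P S P' S' P'' S'' \<phi> \<psi> where xyz: "x = (P, S)" "y = (P', S')" "z = (P'', S'')"
      "x \<in> pconfigs n" "z \<in> pconfigs n" "config_iso \<phi> P P'" "\<phi> ` S = S'" "config_iso \<psi> P' P''" "\<psi> ` S' = S''"
      by (auto simp: pconfig_iso_rel_def)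
    have "(\<psi> \<circ> \<phi>) ` S = S''" using xyz by auto
    then show "(x, z) \<in> pconfig_iso_rel n"
      using xyz config_iso_comp[OF xyz(6,8)] by (auto simp: pconfig_iso_rel_def)
  qed
qed

lemma pconfig_iso_card:
  assumes "((P, S), (P', S')) \<in> pconfig_iso_rel n" and "n \<ge> 1"
  shows "card S' = card S"
proof -
  obtain \<phi> where \<phi>: "config_iso \<phi> P P'" "S' = \<phi> ` S" "(P, S) \<in> pconfigs n"
    using assms by (auto simp: pconfig_iso_rel_def)
  have "inj_on \<phi> P" using \<phi>(1) by (simp add: config_iso_def bij_betw_def)
  then have "inj_on \<phi> S" using pconfigsD(4)[OF \<phi>(3) assms(2)] by (rule inj_on_subset)
  then show ?thesis unfolding \<phi>(2) by (rule card_image)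
qed

lemma flip_graph_vertE:
  assumes "X \<in> flip_graph_verts n"
  obtains P S where "(P, S) \<in> pconfigs n" "X = pconfig_iso_rel n `` {(P, S)}"
  using assms by (auto simp: flip_graph_verts_def elim!: quotientE)

lemma parity_verts_iff:
  assumes n: "n \<ge> 1" and X: "X \<in> flip_graph_verts n" and x: "(P, S) \<in> X"
  shows "X \<in> parity_verts n k \<longleftrightarrow> [card S = k] (mod 2)"
proof -
  have card: "card S' = card S" if "(P', S') \<in> X" for P' S'
  proof -
    have "((P, S), (P', S')) \<in> pconfig_iso_rel n"
      using quotient_eq_iff[OF equiv_pconfig_iso_rel[OF n] _ _ x that] X by (simp add: flip_graph_verts_def)
    then show ?thesis using pconfig_iso_card n by blast
  qed
  show ?thesis
  proof
    assume "X \<in> parity_verts n k"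
    then show "[card S = k] (mod 2)" using x unfolding parity_verts_def by blast
  next
    assume k: "[card S = k] (mod 2)"
    have "[card S' = k] (mod 2)" if "(P', S') \<in> X" for P' S' using card[OF that] k by simp
    then show "X \<in> parity_verts n k" using X unfolding parity_verts_def by blast
  qed
qed

lemma pointed_flip_card:
  fixes P P' :: "(real ^ 'd) set"
  assumes fl: "pointed_flip n (P, S) (P', S')" and n: "n \<ge> 1"
  shows "even (card S' + card S + CARD('d) + 1)"
proof -
  obtain \<gamma> I where PS: "(P, S) \<in> pconfigs n" "(P', S') \<in> pconfigs n" and fl: "flip n \<gamma> I"
    and P: "P = \<gamma> (-1) ` {1..n}" and P': "P' = \<gamma> 1 ` {1..n}"
    and sd: "{i \<in> {1..n}. \<gamma> 1 i \<in> S'} = sym_diff {i \<in> {1..n}. \<gamma> (-1) i \<in> S} I"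
    using fl unfolding pointed_flip_def by blast
  have card: "card {i \<in> {1..n}. f i \<in> R} = card R" if f: "generic_config n (f ` {1..n})" "R \<subseteq> f ` {1..n}"
    for R and f :: "nat \<Rightarrow> real ^ 'd"
  proof -
    have "inj_on f {1..n}" using generic_configD(2)[OF f(1)] by (intro eq_card_imp_inj_on) auto
    moreover have "f ` {i \<in> {1..n}. f i \<in> R} = R" using f(2) by auto
    ultimately show ?thesis
      by (metis (no_types, lifting) card_image inj_on_subset mem_Collect_eq subsetI)
  qed
  have I: "I \<subseteq> {1..n}" "card I = CARD('d) + 1" using fl unfolding flip_def by blast+
  have symd: "even (card (sym_diff A I) + card A + card I)" if "A \<subseteq> {1..n}" for A
  proof -
    have f: "finite A" "finite I" using that I finite_subset by blast+
    have "card (sym_diff A I) = card (A - I) + card (I - A)"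
      using f by (intro card_Un_disjoint) auto
    moreover have "card A = card (A - I) + card (A \<inter> I)" "card I = card (I - A) + card (A \<inter> I)"
      using f by (auto simp: card_Diff_subset_Int card_mono Int_commute)
    ultimately show ?thesis by auto
  qed
  have "card {i \<in> {1..n}. \<gamma> (-1) i \<in> S} = card S"
    using card[of "\<gamma> (-1)" S] pconfigsD[OF PS(1) n] P by simp
  moreover have "card {i \<in> {1..n}. \<gamma> 1 i \<in> S'} = card S'"
    using card[of "\<gamma> 1" S'] pconfigsD[OF PS(2) n] P' by simp
  ultimately show ?thesis
    using symd[of "{i \<in> {1..n}. \<gamma> (-1) i \<in> S}", OF Collect_restrict] unfolding sd[symmetric] I(2)
    by (simp add: add.assoc)
qed

lemma cong_shift_mod_2:
  fixes a b d k :: nat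
  assumes "even (a + b + d + 1)"
  shows "[b = k] (mod 2) \<longleftrightarrow> [a = k + d + 1] (mod 2)"
  using assms by (auto simp: cong_def mod2_eq_if)

lemma flip_graph_edgeE:
  assumes e: "e \<in> (flip_graph_edges n :: 'd::finite pconfig set set set)" and n: "n \<ge> 1"
  obtains X Y where "e = {X, Y}" "X \<in> flip_graph_verts n" "Y \<in> flip_graph_verts n"
    "\<And>k. X \<in> parity_verts n k \<longleftrightarrow> Y \<in> parity_verts n (k + CARD('d) + 1)"
proof -
  obtain X Y P S P' S' where *: "e = {X, Y}" "X \<in> flip_graph_verts n" "Y \<in> flip_graph_verts n"
     "(P, S) \<in> X" "(P', S') \<in> Y" "pointed_flip n (P, S) (P', S')"
    using e unfolding flip_graph_edges_def by auto
  have "X \<in> parity_verts n k \<longleftrightarrow> Y \<in> parity_verts n (k + CARD('d) + 1)" for k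
    unfolding parity_verts_iff[OF n *(2,4)] parity_verts_iff[OF n *(3,5)]
    using pointed_flip_card[OF *(6) n] by (rule cong_shift_mod_2)
  then show thesis using * that by blast
qed

lemma parity_verts_0_iff_not_1:
  assumes "X \<in> flip_graph_verts n" "n \<ge> 1"
  shows "X \<in> parity_verts n 0 \<longleftrightarrow> X \<notin> parity_verts n 1"
proof -
  obtain P S where PS: "(P, S) \<in> pconfigs n" "X = pconfig_iso_rel n `` {(P, S)}"
    using flip_graph_vertE[OF assms(1)] .
  then have "(P, S) \<in> X" using equiv_class_self[OF equiv_pconfig_iso_rel[OF assms(2)]] by simp
  show ?thesis unfolding parity_verts_iff[OF assms(2,1) \<open>(P, S) \<in> X\<close>] by (auto simp: cong_def)
qed

lemma parity_verts_mod2: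
  "k mod 2 = l mod 2 \<Longrightarrow> parity_verts n k = parity_verts n l"
  by (simp add: parity_verts_def cong_def)

lemma flip_graph_bipartite:
  assumes n: "n \<ge> 1" and d: "even CARD('d::finite)"
  shows "is_bipartition (flip_graph_verts n :: 'd pconfig set set) (flip_graph_edges n)
          (parity_verts n 0) (parity_verts n 1)"
  unfolding is_bipartition_def
proof (intro conjI ballI)
  have sub: "parity_verts n k \<subseteq> (flip_graph_verts n :: 'd pconfig set set)" for k
    by (auto simp: parity_verts_def)
  show "parity_verts n 0 \<union> parity_verts n 1 = (flip_graph_verts n :: 'd pconfig set set)"
    "parity_verts n 0 \<inter> parity_verts n 1 = ({} :: 'd pconfig set set)"
    using parity_verts_0_iff_not_1[OF _ n] sub by blast+
  fix e assume "e \<in> (flip_graph_edges n :: 'd pconfig set set set)"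
  then obtain X Y where XY: "e = {X, Y}" "X \<in> flip_graph_verts n" "Y \<in> flip_graph_verts n"
    "\<And>k. X \<in> parity_verts n k \<longleftrightarrow> Y \<in> parity_verts n (k + CARD('d) + 1)"
    using flip_graph_edgeE[OF _ n] by blast
  have "parity_verts n (CARD('d) + 1) = (parity_verts n 1 :: 'd pconfig set set)"
    using d by (intro parity_verts_mod2) presburger
  then have "X \<in> parity_verts n 0 \<longleftrightarrow> Y \<in> parity_verts n 1" using XY(4)[of 0] by simp
  then show "\<exists>x\<in>parity_verts n 0. \<exists>y\<in>parity_verts n 1. e = {x, y}"
    using parity_verts_0_iff_not_1[OF XY(2) n] parity_verts_0_iff_not_1[OF XY(3) n] XY(1) by blast
qed

section \<open>Isomorphisms and flips as steps between configurations\<close>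

text \<open>Genericity of a family of points indexed by \<open>{1..n}\<close>. If \<open>n \<ge> d + 1\<close>, then it forces the points to
  be distinct and to form a generic configuration; for smaller \<open>n\<close> the condition is void.\<close>

definition generic_family :: "nat \<Rightarrow> (nat \<Rightarrow> real ^ 'd) \<Rightarrow> bool" where
  "generic_family n c \<longleftrightarrow>
     (\<forall>J \<subseteq> {1..n}. card J = CARD('d) + 1 \<longrightarrow> \<not> affine_dependent_family c J)"

lemma generic_family_config:
  fixes c :: "nat \<Rightarrow> real ^ 'd"
  assumes c: "generic_family n c" and n: "CARD('d) + 1 \<le> n"
  shows "inj_on c {1..n}" "generic_config n (c ` {1..n})"
proof -
  have ext: "\<exists>J. T \<subseteq> J \<and> J \<subseteq> {1..n} \<and> inj_on c J \<and> \<not> affine_dependent (c ` J)"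
    if "T \<subseteq> {1..n}" "card T \<le> CARD('d) + 1" for T
  proof -
    obtain J where J: "T \<subseteq> J" "J \<subseteq> {1..n}" "card J = CARD('d) + 1"
      using exists_subset_between[of T "CARD('d) + 1" "{1..n}"] \<open>T \<subseteq> {1..n}\<close> \<open>card T \<le> _\<close> n by auto
    have fin: "finite J" using J(2) finite_subset by blast
    have dep: "\<not> affine_dependent_family c J" using c J by (auto simp: generic_family_def)
    then have "inj_on c J" using affine_dependent_family_not_inj[OF _ fin] by blast
    then show ?thesis using J dep affine_dependent_family_inj[OF _ fin] by blast
  qed
  show inj: "inj_on c {1..n}"
  proof (rule inj_onI)
    fix i j assume ij: "i \<in> {1..n}" "j \<in> {1..n}" "c i = c j"
    have "card {i, j} \<le> 2" by (simp add: card_insert_if)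
    moreover have "CARD('d) > 0" by simp
    ultimately have "card {i, j} \<le> CARD('d) + 1" by linarith
    moreover have "{i, j} \<subseteq> {1..n}" using ij(1,2) by simp
    ultimately obtain J where "{i, j} \<subseteq> J" "inj_on c J" using ext[of "{i, j}"] by blast
    then show "i = j" using ij(3) by (auto simp: inj_on_def)
  qed
  have "\<not> affine_dependent T" if T: "T \<subseteq> c ` {1..n}" "card T \<le> CARD('d) + 1" for T
  proof -
    obtain T' where T': "T' \<subseteq> {1..n}" "T = c ` T'" using T(1) by (auto simp: subset_image_iff)
    have "card T' = card T" unfolding T'(2) using inj_on_subset[OF inj T'(1)] by (simp add: card_image)
    then obtain J where "T' \<subseteq> J" "\<not> affine_dependent (c ` J)" using ext[OF T'(1)] T(2) by metis
    then show ?thesis unfolding T'(2) using affine_dependent_subset[OF _ image_mono] by metis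
  qed
  then show "generic_config n (c ` {1..n})"
    unfolding generic_config_def using card_image[OF inj] by simp
qed

lemma generic_config_family:
  fixes c :: "nat \<Rightarrow> real ^ 'd"
  assumes "generic_config n (c ` {1..n})"
  shows "inj_on c {1..n}" "generic_family n c"
proof -
  show inj: "inj_on c {1..n}" using generic_configD(2)[OF assms] by (intro eq_card_imp_inj_on) auto
  show "generic_family n c" unfolding generic_family_def
  proof (intro allI impI)
    fix J assume J: "J \<subseteq> {1..n}" "card J = CARD('d) + 1"
    have injJ: "inj_on c J" using inj_on_subset[OF inj J(1)] .
    have "\<not> affine_dependent (c ` J)"
      using generic_configD(3)[OF assms, of "c ` J"] J card_image[OF injJ] by auto
    then show "\<not> affine_dependent_family c J"
      using affine_dependent_family_inj[OF injJ finite_subset[OF J(1)]] by simp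
  qed
qed

text \<open>The vertex of the flip graph that is represented by \<open>x\<close>.\<close>

abbreviation pconfig_class :: "nat \<Rightarrow> ('d::finite) pconfig \<Rightarrow> 'd pconfig set" where
  "pconfig_class n x \<equiv> pconfig_iso_rel n `` {x}"

text \<open>The edges of the flip graph as a relation; it is symmetric.\<close>

definition adjacent :: "nat \<Rightarrow> (('d::finite) pconfig set \<times> 'd pconfig set) set" where
  "adjacent n = {(X, Y). {X, Y} \<in> flip_graph_edges n}"

text \<open>Every pointed configuration on \<open>P\<close> can be joined in the flip graph to one on \<open>P'\<close>. The selected
  class on \<open>P'\<close> is determined by the path and need not be prescribed.\<close>

definition linked :: "nat \<Rightarrow> (real ^ 'd) set \<Rightarrow> (real ^ 'd) set \<Rightarrow> bool" where
  "linked n P P' \<longleftrightarrow> (\<forall>S. (P, S) \<in> pconfigs n \<longrightarrow> (\<exists>S'. (P', S') \<in> pconfigs n \<and>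
     (pconfig_class n (P, S), pconfig_class n (P', S')) \<in> (adjacent n)\<^sup>*))"

lemma linked_refl: "linked n P P"
  unfolding linked_def by blast

lemma linked_trans: "linked n P P' \<Longrightarrow> linked n P' P'' \<Longrightarrow> linked n P P''"
  unfolding linked_def by (meson rtrancl_trans)

lemma linked_same_orientations:
  fixes c c' :: "nat \<Rightarrow> real ^ 'd"
  assumes n: "n \<ge> 1" and gen: "generic_config n (c ` {1..n})" "generic_config n (c' ` {1..n})"
    and same: "same_orientations_except {1..n} {} c c'"
  shows "linked n (c ` {1..n}) (c' ` {1..n})"
  unfolding linked_def
proof (intro allI impI)
  fix S assume S: "(c ` {1..n}, S) \<in> pconfigs n"
  let ?N = "{1..n}"
  have inj: "inj_on c ?N" "inj_on c' ?N" using generic_config_family gen by auto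
  define \<phi> where "\<phi> = c' \<circ> inv_into ?N c"
  have \<phi>: "\<phi> (c i) = c' i" if "i \<in> ?N" for i using inj that by (simp add: \<phi>_def)
  define A where "A = {i \<in> ?N. c i \<in> S}"
  have "S \<subseteq> c ` ?N" using pconfigsD[OF S n] by simp
  then have SA: "S = c ` A" by (auto simp: A_def)
  have A: "A \<subseteq> ?N" by (auto simp: A_def)
  have "c' ` A \<in> orchard_classes (c' ` ?N)"
    using orchard_classes_orientation_change[OF gen(1) inj(1) gen(2) inj(2) same _ A] pconfigsD(3)[OF S n] n
    by (simp add: SA)
  then have S': "(c' ` ?N, c' ` A) \<in> pconfigs n" using gen(2) by (simp add: pconfigs_def)
  have "config_iso \<phi> (c ` ?N) (c' ` ?N)" unfolding config_iso_def
  proof (intro conjI ballI allI impI)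
    show "bij_betw \<phi> (c ` ?N) (c' ` ?N)" unfolding \<phi>_def
      by (rule bij_betw_trans[OF bij_betw_inv_into[OF inj_on_imp_bij_betw[OF inj(1)]]
            inj_on_imp_bij_betw[OF inj(2)]])
    fix p :: "real ^ 'd" and q :: "'d \<Rightarrow> real ^ 'd" assume p: "p \<in> c ` ?N" and q: "range q \<subseteq> c ` ?N"
    obtain i where i: "i \<in> ?N" "p = c i" using p by auto
    have "q k \<in> c ` ?N" for k using q by blast
    then have "\<forall>k. \<exists>j. j \<in> ?N \<and> q k = c j" by blast
    then obtain e where e: "\<And>k. e k \<in> ?N" "\<And>k. q k = c (e k)" by metis
    have q: "q = c \<circ> e" "\<phi> \<circ> q = c' \<circ> e" using e \<phi> by (auto simp: fun_eq_iff)
    show "orientation (\<phi> p) (\<phi> \<circ> q) = orientation p q"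
    proof (cases "inj e \<and> i \<notin> range e")
      case True
      then have "inj e" "range e \<subseteq> ?N - {i}" using e(1) by auto
      from same[unfolded same_orientations_except_def, rule_format, OF i(1) this]
      have "orientation (c' i) (c' \<circ> e) = orientation (c i) (c \<circ> e)" by simp
      then show ?thesis using i \<phi> q by simp
    next
      case False
      \<comment> \<open>Repeated vertices make both determinants vanish.\<close>
      then show ?thesis using i \<phi> simplex_det_not_inj[of e i c] simplex_det_not_inj[of e i c']
        unfolding q(2) unfolding q(1) by (simp add: orientation_eq_sgn)
    qed
  qed
  moreover have "\<phi> ` S = c' ` A"
    unfolding SA image_image by (intro image_cong refl \<phi>) (use A in auto)
  ultimately have "((c ` ?N, S), (c' ` ?N, c' ` A)) \<in> pconfig_iso_rel n"
    using S S' unfolding pconfig_iso_rel_def by blast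
  then have "pconfig_class n (c ` ?N, S) = pconfig_class n (c' ` ?N, c' ` A)"
    by (rule equiv_class_eq[OF equiv_pconfig_iso_rel[OF n]])
  then show "\<exists>S'. (c' ` ?N, S') \<in> pconfigs n \<and>
      (pconfig_class n (c ` ?N, S), pconfig_class n (c' ` ?N, S')) \<in> (adjacent n)\<^sup>*"
    using S' by auto
qed

lemma linked_flip:
  fixes \<gamma> :: "real \<Rightarrow> nat \<Rightarrow> real ^ 'd"
  assumes n: "n \<ge> 1" and fl: "flip n \<gamma> I"
    and same: "same_orientations_except {1..n} I (\<gamma> (-1)) (\<gamma> 1)"
  shows "linked n (\<gamma> (-1) ` {1..n}) (\<gamma> 1 ` {1..n})"
  unfolding linked_def
proof (intro allI impI)
  let ?N = "{1..n}"
  let ?c = "\<gamma> (-1)" and ?c' = "\<gamma> 1"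
  fix S assume S: "(?c ` ?N, S) \<in> pconfigs n"
  have I: "I \<subseteq> ?N" "card I = CARD('d) + 1" using fl unfolding flip_def by blast+
  have gen: "generic_config n (?c ` ?N)" "generic_config n (?c' ` ?N)"
    using fl unfolding flip_def by auto
  have inj: "inj_on ?c ?N" "inj_on ?c' ?N" using generic_config_family gen by auto
  define A where "A = {i \<in> ?N. ?c i \<in> S}"
  define B where "B = sym_diff A I"
  have "S \<subseteq> ?c ` ?N" using pconfigsD[OF S n] by simp
  then have SA: "S = ?c ` A" by (auto simp: A_def)
  have A: "A \<subseteq> ?N" by (auto simp: A_def)
  then have B: "B \<subseteq> ?N" using I by (auto simp: B_def)
  have "?c' ` B \<in> orchard_classes (?c' ` ?N)" unfolding B_def
    using orchard_classes_orientation_change[OF gen(1) inj(1) gen(2) inj(2) same _ A] pconfigsD(3)[OF S n] n I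
    by (simp add: SA)
  then have S': "(?c' ` ?N, ?c' ` B) \<in> pconfigs n" using gen(2) by (simp add: pconfigs_def)
  have "{i \<in> ?N. ?c' i \<in> ?c' ` B} = B"
    using B inj_on_image_mem_iff[OF inj(2) _ B] by blast
  then have "{i \<in> ?N. ?c' i \<in> ?c' ` B} = sym_diff {i \<in> ?N. ?c i \<in> S} I" by (simp add: B_def A_def)
  then have "pointed_flip n (?c ` ?N, S) (?c' ` ?N, ?c' ` B)"
    unfolding pointed_flip_def using S S' fl by blast
  moreover have "pconfig_class n x \<in> flip_graph_verts n \<and> x \<in> pconfig_class n x" if "x \<in> pconfigs n"
    for x :: "'d pconfig"
    unfolding flip_graph_verts_def
    using quotientI[OF that] equiv_class_self[OF equiv_pconfig_iso_rel[OF n] that] by blast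
  ultimately have "(pconfig_class n (?c ` ?N, S), pconfig_class n (?c' ` ?N, ?c' ` B)) \<in> adjacent n"
    using S S' unfolding adjacent_def flip_graph_edges_def by blast
  then show "\<exists>S'. (?c' ` ?N, S') \<in> pconfigs n \<and>
      (pconfig_class n (?c ` ?N, S), pconfig_class n (?c' ` ?N, S')) \<in> (adjacent n)\<^sup>*"
    using S' by blast
qed

section \<open>Moving one point along a line\<close>

lemma simplex_det_move_point:
  fixes c :: "'i \<Rightarrow> real ^ 'd"
  assumes "inj e" "i \<notin> range e"
  shows "\<exists>a b. \<forall>x. simplex_det ((c(k := x)) i) (c(k := x) \<circ> e) = a \<bullet> x - b"
proof -
  consider "i = k" | j where "k = e j" | "i \<noteq> k" "k \<notin> range e" by auto
  then show ?thesis
  proof cases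
    case 1
    then have "c(k := x) \<circ> e = c \<circ> e" for x using assms(2) by (auto simp: fun_eq_iff)
    then show ?thesis using simplex_det_affine_base[of "c \<circ> e"] 1 by simp
  next
    case 2
    then have "c(k := x) \<circ> e = (c \<circ> e)(j := x)" for x using assms(1) by (auto simp: fun_eq_iff inj_def)
    moreover have "i \<noteq> k" using assms(2) 2 by auto
    ultimately show ?thesis using simplex_det_affine_vertex[of "c i" "c \<circ> e" j] by simp
  next
    case 3
    then have "c(k := x) \<circ> e = c \<circ> e" for x by (auto simp: fun_eq_iff)
    then show ?thesis using 3
      by (intro exI[of _ 0] exI[of _ "- simplex_det (c i) (c \<circ> e)"]) simp
  qed
qed

text \<open>A function of the points with indices in \<open>J\<close>, where \<open>card J = d + 1\<close>, that vanishes exactly when these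
  points are dependent. The sign depends on an arbitrary enumeration of \<open>J\<close>; only the zeros and the
  affine dependence on each single point matter.\<close>

definition family_det :: "('i \<Rightarrow> real ^ 'd) \<Rightarrow> 'i set \<Rightarrow> real" where
  "family_det c J = (let i = (SOME i. i \<in> J); e = (SOME e :: 'd \<Rightarrow> 'i. bij_betw e UNIV (J - {i}))
     in simplex_det (c i) (c \<circ> e))"

lemma family_det_enumeration:
  assumes J: "card J = CARD('d::finite) + 1"
  obtains i and e :: "'d::finite \<Rightarrow> 'i" where "i \<in> J" "bij_betw e UNIV (J - {i})" "inj e" "i \<notin> range e"
    "\<And>c :: 'i \<Rightarrow> real ^ 'd::finite. family_det c J = simplex_det (c i) (c \<circ> e)"
proof -
  define i where "i = (SOME i. i \<in> J)"
  define e where "e = (SOME e :: 'd \<Rightarrow> 'i. bij_betw e UNIV (J - {i}))"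
  have "J \<noteq> {}" using J by auto
  then have i: "i \<in> J" unfolding i_def by (simp add: some_in_eq)
  then have "card (J - {i}) = CARD('d)" using J by (simp add: card_Diff_singleton)
  then have e: "bij_betw e UNIV (J - {i})"
    unfolding e_def by (metis (mono_tags) ex_enumeration someI_ex)
  show thesis
  proof (rule that[OF i e])
    show "inj e" "i \<notin> range e" using e by (auto simp: bij_betw_def)
    show "family_det c J = simplex_det (c i) (c \<circ> e)" for c :: "'i \<Rightarrow> real ^ 'd"
      by (simp add: family_det_def i_def e_def Let_def)
  qed
qed

lemma family_det_eq_0_iff:
  fixes c :: "'i \<Rightarrow> real ^ 'd"
  assumes "card J = CARD('d) + 1"
  shows "family_det c J = 0 \<longleftrightarrow> affine_dependent_family c J"
  using family_det_enumeration[OF assms] affine_dependent_family_iff by metis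

lemma family_det_move_point:
  fixes c :: "'i \<Rightarrow> real ^ 'd"
  assumes "card J = CARD('d) + 1"
  shows "\<exists>a b. \<forall>x. family_det (c(k := x)) J = a \<bullet> x - b"
proof -
  obtain i and e :: "'d \<Rightarrow> 'i" where e: "inj e" "i \<notin> range e"
    "\<And>c :: 'i \<Rightarrow> real ^ 'd. family_det c J = simplex_det (c i) (c \<circ> e)"
    using family_det_enumeration[OF assms] by metis
  show ?thesis unfolding e(3) by (rule simplex_det_move_point[OF e(1,2)])
qed

lemma family_det_segment:
  fixes c :: "'i \<Rightarrow> real ^ 'd"
  assumes "card J = CARD('d) + 1"
  shows "family_det (c(k := x + t *\<^sub>R (y - x))) J =
    (1 - t) * family_det (c(k := x)) J + t * family_det (c(k := y)) J"
proof -
  obtain a b where ab: "\<And>x. family_det (c(k := x)) J = a \<bullet> x - b"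
    using family_det_move_point[OF assms] by metis
  show ?thesis unfolding ab by (simp add: inner_add_right inner_diff_right algebra_simps)
qed

lemma affine_same_sign:
  fixes \<alpha> \<beta> s t :: real
  assumes "s \<le> t" "\<And>u. s \<le> u \<Longrightarrow> u \<le> t \<Longrightarrow> \<alpha> + \<beta> * u \<noteq> 0"
  shows "sgn (\<alpha> + \<beta> * s) = sgn (\<alpha> + \<beta> * t)"
proof (rule ccontr)
  assume *: "sgn (\<alpha> + \<beta> * s) \<noteq> sgn (\<alpha> + \<beta> * t)"
  have cont: "continuous_on {s..t} (\<lambda>u. \<alpha> + \<beta> * u)" by (intro continuous_intros)
  have "\<exists>u. s \<le> u \<and> u \<le> t \<and> \<alpha> + \<beta> * u = 0"
    using * IVT'[of "\<lambda>u. \<alpha> + \<beta> * u" s 0 t, OF _ _ assms(1) cont]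
      IVT2'[of "\<lambda>u. \<alpha> + \<beta> * u" t 0 s, OF _ _ assms(1) cont]
    by (cases "\<alpha> + \<beta> * s" "0 :: real" rule: linorder_cases;
        cases "\<alpha> + \<beta> * t" "0 :: real" rule: linorder_cases) auto
  then show False using assms(2) by blast
qed

lemma indexed_simplex:
  fixes c :: "nat \<Rightarrow> real ^ 'd"
  assumes "i \<in> {1..n}" "inj e" "range e \<subseteq> {1..n} - {i}"
  shows "insert i (range e) \<subseteq> {1..n}" "card (insert i (range e)) = CARD('d) + 1"
    "affine_dependent_family c (insert i (range e)) \<longleftrightarrow> simplex_det (c i) (c \<circ> e) = 0"
proof -
  show "insert i (range e) \<subseteq> {1..n}" using assms by auto
  have i: "i \<notin> range e" using assms(3) by auto
  then show "card (insert i (range e)) = CARD('d) + 1" using card_image[OF assms(2)] by simp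
  have "bij_betw e UNIV (insert i (range e) - {i})" using i assms(2) by (simp add: bij_betw_def)
  then show "affine_dependent_family c (insert i (range e)) \<longleftrightarrow> simplex_det (c i) (c \<circ> e) = 0"
    by (intro affine_dependent_family_iff) auto
qed

lemma simplex_det_line:
  fixes c :: "'i \<Rightarrow> real ^ 'd"
  assumes "inj e" "i \<notin> range e"
  obtains \<alpha> \<beta> where "\<And>t. simplex_det ((c(k := x + t *\<^sub>R w)) i) (c(k := x + t *\<^sub>R w) \<circ> e) = \<alpha> + \<beta> * t"
proof -
  obtain a b where "\<And>x. simplex_det ((c(k := x)) i) (c(k := x) \<circ> e) = a \<bullet> x - b"
    using simplex_det_move_point[OF assms] by metis
  then show thesis by (intro that[of "a \<bullet> x - b" "a \<bullet> w"]) (simp add: inner_add_right algebra_simps)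
qed

lemma linked_line_generic:
  fixes c :: "nat \<Rightarrow> real ^ 'd"
  assumes n: "CARD('d) + 1 \<le> n" and st: "s \<le> t"
    and gen: "\<And>u. s \<le> u \<Longrightarrow> u \<le> t \<Longrightarrow> generic_family n (c(k := x + u *\<^sub>R w))"
  shows "linked n (c(k := x + s *\<^sub>R w) ` {1..n}) (c(k := x + t *\<^sub>R w) ` {1..n})"
proof (rule linked_same_orientations)
  show "1 \<le> n" using n by simp
  show "generic_config n (c(k := x + s *\<^sub>R w) ` {1..n})" "generic_config n (c(k := x + t *\<^sub>R w) ` {1..n})"
    using generic_family_config(2)[OF gen n] st by auto
  show "same_orientations_except {1..n} {} (c(k := x + s *\<^sub>R w)) (c(k := x + t *\<^sub>R w))"
    unfolding same_orientations_except_def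
  proof (intro ballI allI impI)
    fix i and e :: "'d \<Rightarrow> nat" assume e: "i \<in> {1..n}" "inj e" "range e \<subseteq> {1..n} - {i}"
    then have "i \<notin> range e" by auto
    then obtain \<alpha> \<beta> where ab: "\<And>t. simplex_det ((c(k := x + t *\<^sub>R w)) i) (c(k := x + t *\<^sub>R w) \<circ> e) = \<alpha> + \<beta> * t"
      using simplex_det_line[OF e(2)] by metis
    have "\<alpha> + \<beta> * u \<noteq> 0" if "s \<le> u" "u \<le> t" for u
      using gen[OF that] indexed_simplex[OF e] unfolding ab[symmetric] generic_family_def by blast
    then have "sgn (\<alpha> + \<beta> * s) = sgn (\<alpha> + \<beta> * t)" by (rule affine_same_sign[OF st])
    then show "orientation ((c(k := x + t *\<^sub>R w)) i) (c(k := x + t *\<^sub>R w) \<circ> e) =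
       (if insert i (range e) = {} then - orientation ((c(k := x + s *\<^sub>R w)) i) (c(k := x + s *\<^sub>R w) \<circ> e)
        else orientation ((c(k := x + s *\<^sub>R w)) i) (c(k := x + s *\<^sub>R w) \<circ> e))"
      unfolding orientation_eq_sgn ab by simp
  qed
qed

text \<open>If one point moves on a line and exactly one \<open>(d + 1)\<close>-subset becomes dependent at time \<open>\<tau>\<close>, then
  passing this time is a flip. Any determinant is affine in the time, so a determinant that vanishes
  at \<open>\<tau>\<close> has opposite signs before and after. A further index \<open>s\<close>, available because
  \<open>n \<ge> d + 2\<close>, shows that any \<open>d\<close> points of the flipset are still independent at time \<open>\<tau>\<close> and thus
  span the hyperplane that contains the flipset.\<close>

lemma linked_line_flip:
  fixes c :: "nat \<Rightarrow> real ^ 'd"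
  assumes n: "CARD('d) + 2 \<le> n" and eps: "\<epsilon> > 0"
    and gen: "\<And>u. u \<noteq> 0 \<Longrightarrow> \<bar>u\<bar> \<le> \<epsilon> \<Longrightarrow> generic_family n (c(k := x + (\<tau> + u) *\<^sub>R w))"
    and J: "J \<subseteq> {1..n}" "card J = CARD('d) + 1"
    and dep: "\<And>J'. J' \<subseteq> {1..n} \<Longrightarrow> card J' = CARD('d) + 1 \<Longrightarrow>
      affine_dependent_family (c(k := x + \<tau> *\<^sub>R w)) J' \<longleftrightarrow> J' = J"
  shows "linked n (c(k := x + (\<tau> - \<epsilon>) *\<^sub>R w) ` {1..n}) (c(k := x + (\<tau> + \<epsilon>) *\<^sub>R w) ` {1..n})"
proof -
  define \<gamma> where "\<gamma> t = c(k := x + (\<tau> + \<epsilon> * t) *\<^sub>R w)" for t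
  let ?c = "\<gamma> 0"
  have c0: "?c = c(k := x + \<tau> *\<^sub>R w)" by (simp add: \<gamma>_def)
  have fin: "finite J" using J(1) finite_subset by blast
  have genf: "generic_family n (\<gamma> t)" if "t \<noteq> 0" "\<bar>t\<bar> \<le> 1" for t
    unfolding \<gamma>_def using that eps by (intro gen) (auto simp: abs_mult)
  have same: "same_orientations_except {1..n} J (\<gamma> (-1)) (\<gamma> 1)"
    unfolding same_orientations_except_def
  proof (intro ballI allI impI)
    fix i and e :: "'d \<Rightarrow> nat" assume e: "i \<in> {1..n}" "inj e" "range e \<subseteq> {1..n} - {i}"
    then have "i \<notin> range e" by auto
    then obtain \<alpha> \<beta> where ab: "\<And>t. simplex_det ((c(k := (x + \<tau> *\<^sub>R w) + t *\<^sub>R (\<epsilon> *\<^sub>R w))) i)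
        (c(k := (x + \<tau> *\<^sub>R w) + t *\<^sub>R (\<epsilon> *\<^sub>R w)) \<circ> e) = \<alpha> + \<beta> * t"
      using simplex_det_line[OF e(2)] by metis
    have "\<gamma> t = c(k := (x + \<tau> *\<^sub>R w) + t *\<^sub>R (\<epsilon> *\<^sub>R w))" for t by (simp add: \<gamma>_def algebra_simps)
    then have ab: "simplex_det (\<gamma> t i) (\<gamma> t \<circ> e) = \<alpha> + \<beta> * t" for t using ab by simp
    note es = indexed_simplex[OF e]
    show "orientation (\<gamma> 1 i) (\<gamma> 1 \<circ> e) =
       (if insert i (range e) = J then - orientation (\<gamma> (-1) i) (\<gamma> (-1) \<circ> e)
        else orientation (\<gamma> (-1) i) (\<gamma> (-1) \<circ> e))"
    proof (cases "insert i (range e) = J")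
      case True
      then have "\<alpha> + \<beta> * 0 = 0" using es(3)[of ?c] dep[OF es(1,2)] c0 unfolding ab by simp
      then show ?thesis using True unfolding orientation_eq_sgn ab by simp
    next
      case False
      have "\<alpha> + \<beta> * u \<noteq> 0" if "-1 \<le> u" "u \<le> 1" for u
      proof (cases "u = 0")
        case True
        then show ?thesis using es(3)[of ?c] dep[OF es(1,2)] c0 False unfolding ab by simp
      next
        case False
        then have "generic_family n (\<gamma> u)" using that by (intro genf) auto
        then show ?thesis using es unfolding ab[symmetric] generic_family_def by blast
      qed
      then have "sgn (\<alpha> + \<beta> * (-1)) = sgn (\<alpha> + \<beta> * 1)" by (intro affine_same_sign) auto
      then show ?thesis using False unfolding orientation_eq_sgn ab by simp
    qed
  qed
  have "flip n \<gamma> J" unfolding flip_def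
  proof (intro conjI ballI allI impI)
    fix i
    show "continuous_on {-1..1} (\<lambda>t. \<gamma> t i)"
      unfolding \<gamma>_def by (cases "i = k") (auto intro!: continuous_intros)
  next
    fix t :: real assume "t \<in> {-1..1} - {0}"
    then have "generic_family n (\<gamma> t)" by (intro genf) auto
    then show "generic_config n (\<gamma> t ` {1..n})"
      by (rule generic_family_config(2)) (use n in simp)
  next
    show "{J. J \<subseteq> {1..n} \<and> card J = CARD('d) + 1 \<and> affine_dependent_family (\<gamma> 0) J} = {J}"
      using dep J unfolding c0 by blast
  next
    have "J \<noteq> {1..n}" using J n by auto
    then obtain s where s: "s \<in> {1..n}" "s \<notin> J" using J(1) by blast
    obtain i0 and e :: "'d \<Rightarrow> nat" where i0: "i0 \<in> J" and e: "bij_betw e UNIV (J - {i0})"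
      using family_det_enumeration[OF J(2)] by metis
    obtain a b where ab: "\<And>x. simplex_det x (?c \<circ> e) = a \<bullet> x - b"
      using simplex_det_affine_base by metis
    have indep: "\<not> affine_dependent_family ?c (insert s T)" if "T \<subseteq> J" "card T = CARD('d)" for T
    proof -
      have "finite T" "s \<notin> T" using fin that s finite_subset by auto
      then have "card (insert s T) = CARD('d) + 1" using that by simp
      moreover have "insert s T \<subseteq> {1..n}" "insert s T \<noteq> J" using that s J by auto
      ultimately show ?thesis using dep unfolding c0 by blast
    qed
    have on: "a \<bullet> ?c i = b" if "i \<in> J" for i
    proof (cases "i = i0")
      case True
      have "simplex_det (?c i0) (?c \<circ> e) = 0"
        using dep[OF J] affine_dependent_family_iff[OF i0 e, of ?c] unfolding c0 by simp
      then show ?thesis using ab True by simp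
    next
      case False
      then have "i \<in> range e" using e that by (auto simp: bij_betw_def)
      then show ?thesis using simplex_det_not_inj[of e i ?c] ab by simp
    qed
    have a0: "a \<noteq> 0"
    proof
      assume "a = 0"
      have "card (J - {i0}) = CARD('d)" using i0 J(2) by (simp add: card_Diff_singleton)
      then have "\<not> affine_dependent_family ?c (insert s (J - {i0}))" by (intro indep) auto
      moreover have "bij_betw e UNIV (insert s (J - {i0}) - {s})" using e s by simp
      ultimately have "simplex_det (?c s) (?c \<circ> e) \<noteq> 0"
        using affine_dependent_family_iff[of s "insert s (J - {i0})" e ?c] by simp
      then show False using on[OF i0] by (simp add: ab \<open>a = 0\<close>)
    qed
    have hull: "affine hull (?c ` T) = {x. a \<bullet> x = b}" if "T \<subseteq> J" "card T = CARD('d)" for T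
    proof -
      have finT: "finite (insert s T)" using fin that finite_subset by auto
      then have inj: "inj_on ?c (insert s T)"
        using indep[OF that] affine_dependent_family_not_inj by blast
      then have "\<not> affine_dependent (?c ` insert s T)"
        using indep[OF that] affine_dependent_family_inj[OF _ finT] by blast
      then have "\<not> affine_dependent (?c ` T)" by (rule contrapos_nn) (erule affine_dependent_subset, auto)
      moreover have "card (?c ` T) = CARD('d)"
        using card_image[OF inj_on_subset[OF inj, of T]] that(2) by auto
      ultimately show ?thesis
        using a0 on that(1) by (intro affine_hull_eq_hyperplane) auto
    qed
    show "\<exists>a b. a \<noteq> 0 \<and> (\<forall>i\<in>J. ?c i \<in> {x. a \<bullet> x = b}) \<and>
        (\<forall>T\<subseteq>J. card T = CARD('d) \<longrightarrow> affine hull (?c ` T) = {x. a \<bullet> x = b})"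
      by (intro exI[of _ a] exI[of _ b] conjI ballI allI impI a0 hull CollectI on)
  next
    fix i0 and e :: "'d \<Rightarrow> nat" assume i0: "i0 \<in> J" and e: "bij_betw e UNIV (J - {i0})"
    then have "inj e" "range e = J - {i0}" by (auto simp: bij_betw_def)
    moreover from this have "range e \<subseteq> {1..n} - {i0}" "insert i0 (range e) = J" using J i0 by auto
    ultimately show "orientation (\<gamma> 1 i0) (\<gamma> 1 \<circ> e) = - orientation (\<gamma> (-1) i0) (\<gamma> (-1) \<circ> e)"
      using same J(1) i0 unfolding same_orientations_except_def by auto
  qed
  from linked_flip[OF _ this same] n show ?thesis by (simp add: \<gamma>_def)
qed

text \<open>If no two \<open>(d + 1)\<close>-subsets become dependent at the same time, then the motion along the segment
  passes finitely many times that are not generic; they are crossed one by one, by induction on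
  the number of those that remain.\<close>

lemma linked_segment:
  fixes c :: "nat \<Rightarrow> real ^ 'd"
  assumes n: "CARD('d) + 2 \<le> n"
    and gen: "generic_family n (c(k := x))" "generic_family n (c(k := y))"
    and single: "\<And>t J J'. 0 \<le> t \<Longrightarrow> t \<le> 1 \<Longrightarrow> J \<subseteq> {1..n} \<Longrightarrow> J' \<subseteq> {1..n} \<Longrightarrow>
      card J = CARD('d) + 1 \<Longrightarrow> card J' = CARD('d) + 1 \<Longrightarrow>
      affine_dependent_family (c(k := x + t *\<^sub>R (y - x))) J \<Longrightarrow>
      affine_dependent_family (c(k := x + t *\<^sub>R (y - x))) J' \<Longrightarrow> J = J'"
  shows "linked n (c(k := x) ` {1..n}) (c(k := y) ` {1..n})"
proof -
  let ?N = "{1..n}"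
  define w where "w = y - x"
  define g where "g t = c(k := x + t *\<^sub>R w)" for t
  have g01: "g 0 = c(k := x)" "g 1 = c(k := y)" by (simp_all add: g_def w_def)
  define Z where "Z = {t \<in> {0..1}. \<not> generic_family n (g t)}"
  have "finite Z"
  proof -
    let ?JJ = "{J. J \<subseteq> ?N \<and> card J = CARD('d) + 1}"
    have "finite {t. affine_dependent_family (g t) J}" if "J \<in> ?JJ" for J
    proof -
      have J: "card J = CARD('d) + 1" using that by simp
      define A B where "A = family_det (c(k := x)) J" and "B = family_det (c(k := y)) J"
      have "A \<noteq> 0" using gen(1) that family_det_eq_0_iff[OF J] by (auto simp: generic_family_def A_def)
      have "family_det (g t) J = (1 - t) * A + t * B" for t
        unfolding g_def w_def A_def B_def by (rule family_det_segment[OF J])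
      then have "affine_dependent_family (g t) J \<longleftrightarrow> (1 - t) * A + t * B = 0" for t
        using family_det_eq_0_iff[OF J, of "g t"] by simp
      then have "affine_dependent_family (g t) J \<longleftrightarrow> t * (A - B) = A" for t
        by (auto simp: algebra_simps)
      moreover have "t * (A - B) = A \<Longrightarrow> t = A / (A - B)" for t
        using \<open>A \<noteq> 0\<close> by (cases "A = B") (auto simp: field_simps)
      ultimately have "{t. affine_dependent_family (g t) J} \<subseteq> {A / (A - B)}" by blast
      then show ?thesis using finite_subset by blast
    qed
    then have "finite (\<Union>J\<in>?JJ. {t. affine_dependent_family (g t) J})"
      by (intro finite_UN_I) (auto intro: finite_subset[of _ "Pow ?N"])
    moreover have "Z \<subseteq> (\<Union>J\<in>?JJ. {t. affine_dependent_family (g t) J})"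
      by (auto simp: Z_def generic_family_def)
    ultimately show ?thesis by (rule finite_subset[rotated])
  qed
  have n1: "CARD('d) + 1 \<le> n" using n by simp
  have genZ: "generic_family n (g t)" if "0 \<le> t" "t \<le> 1" "t \<notin> Z" for t
    using that by (simp add: Z_def)
  have "1 \<notin> Z" using gen(2) by (simp add: Z_def g01)
  have "linked n (g s ` ?N) (g 1 ` ?N)" if "0 \<le> s" "s \<le> 1" "s \<notin> Z" for s
    using that
  proof (induction "card {z \<in> Z. s < z}" arbitrary: s rule: less_induct)
    case less
    show ?case
    proof (cases "{z \<in> Z. s < z} = {}")
      case True
      then have "generic_family n (g u)" if "s \<le> u" "u \<le> 1" for u
      proof (intro genZ)
        show "u \<notin> Z" using True that less.prems by (cases "u = s") auto
      qed (use that less.prems in auto)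
      then show ?thesis unfolding g_def using linked_line_generic[OF n1 less.prems(2)] by blast
    next
      case False
      define \<tau> where "\<tau> = Min {z \<in> Z. s < z}"
      have finS: "finite {z \<in> Z. s < z}" using \<open>finite Z\<close> by simp
      have \<tau>: "\<tau> \<in> Z" "s < \<tau>" using Min_in[OF finS False] by (auto simp: \<tau>_def)
      have \<tau>min: "\<tau> \<le> z" if "z \<in> Z" "s < z" for z
        unfolding \<tau>_def using that finS by (intro Min_le) auto
      have "\<tau> < 1" using \<tau>(1) \<open>1 \<notin> Z\<close> by (cases "\<tau> = 1") (auto simp: Z_def)
      obtain \<delta> where \<delta>: "\<delta> > 0" "\<And>z. z \<in> Z \<Longrightarrow> z \<noteq> \<tau> \<Longrightarrow> \<delta> \<le> dist \<tau> z"
        using finite_set_avoid[OF \<open>finite Z\<close>, of \<tau>] by blast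
      \<comment> \<open>So small that the interval around \<open>\<tau>\<close> stays between \<open>s\<close> and 1 and contains no other exceptional
        time.\<close>
      define \<epsilon> where "\<epsilon> = min \<delta> (min (\<tau> - s) (1 - \<tau>)) / 2"
      have \<epsilon>: "\<epsilon> > 0" "\<epsilon> < \<delta>" "\<epsilon> < \<tau> - s" "\<epsilon> < 1 - \<tau>"
        using \<delta>(1) \<tau>(2) \<open>\<tau> < 1\<close> by (auto simp: \<epsilon>_def min_def)
      have near: "generic_family n (g (\<tau> + u))" if "u \<noteq> 0" "\<bar>u\<bar> \<le> \<epsilon>" for u
      proof (rule genZ)
        show "0 \<le> \<tau> + u" "\<tau> + u \<le> 1" using that \<epsilon> less.prems by auto
        show "\<tau> + u \<notin> Z"
        proof
          assume "\<tau> + u \<in> Z"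
          then have "\<delta> \<le> dist \<tau> (\<tau> + u)" using that(1) by (intro \<delta>(2)) auto
          then show False using that(2) \<epsilon>(2) by (simp add: dist_real_def)
        qed
      qed
      have "linked n (g s ` ?N) (g (\<tau> - \<epsilon>) ` ?N)" unfolding g_def
      proof (rule linked_line_generic[OF n1])
        show "s \<le> \<tau> - \<epsilon>" using \<epsilon> by simp
        fix u assume u: "s \<le> u" "u \<le> \<tau> - \<epsilon>"
        have "u \<notin> Z" using u \<tau>min[of u] \<epsilon>(1) less.prems(3) by (cases "u = s") auto
        then show "generic_family n (c(k := x + u *\<^sub>R w))"
          using genZ[of u] u \<epsilon> less.prems \<open>\<tau> < 1\<close> by (simp add: g_def)
      qed
      moreover have "linked n (g (\<tau> - \<epsilon>) ` ?N) (g (\<tau> + \<epsilon>) ` ?N)"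
      proof -
        obtain J where J: "J \<subseteq> ?N" "card J = CARD('d) + 1" "affine_dependent_family (g \<tau>) J"
          using \<tau>(1) by (auto simp: Z_def generic_family_def)
        have "affine_dependent_family (g \<tau>) J' \<longleftrightarrow> J' = J" if "J' \<subseteq> ?N" "card J' = CARD('d) + 1" for J'
        proof
          assume "affine_dependent_family (g \<tau>) J'"
          then show "J' = J"
            using single[of \<tau> J' J] J that \<tau>(1) by (auto simp: Z_def g_def w_def)
        qed (use J in simp)
        then show ?thesis
          using near unfolding g_def by (intro linked_line_flip[OF n \<epsilon>(1) _ J(1,2)]) auto
      qed
      moreover have "linked n (g (\<tau> + \<epsilon>) ` ?N) (g 1 ` ?N)"
      proof (rule less.hyps)
        show "0 \<le> \<tau> + \<epsilon>" "\<tau> + \<epsilon> \<le> 1" using \<epsilon> less.prems by auto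
        show "\<tau> + \<epsilon> \<notin> Z"
        proof
          assume "\<tau> + \<epsilon> \<in> Z"
          then show False using near[of \<epsilon>] \<epsilon>(1) by (simp add: Z_def)
        qed
        have "\<tau> \<in> {z \<in> Z. s < z} - {z \<in> Z. \<tau> + \<epsilon> < z}" using \<tau> \<epsilon>(1) by simp
        moreover have "{z \<in> Z. \<tau> + \<epsilon> < z} \<subseteq> {z \<in> Z. s < z}" using \<tau>(2) \<epsilon>(1) by auto
        ultimately have "{z \<in> Z. \<tau> + \<epsilon> < z} \<subset> {z \<in> Z. s < z}" by blast
        then show "card {z \<in> Z. \<tau> + \<epsilon> < z} < card {z \<in> Z. s < z}"
          by (rule psubset_card_mono[OF finS])
      qed
      ultimately show ?thesis using linked_trans by blast
    qed
  qed
  from this[of 0] show ?thesis using gen(1) by (simp add: Z_def g01)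
qed

text \<open>Along the segment from \<open>x\<close> to \<open>y\<close> two affine functions with values \<open>A\<close>, \<open>A'\<close> at \<open>x\<close> and \<open>B\<close>, \<open>B'\<close> at
  \<open>y\<close> have no common zero if \<open>A B' \<noteq> A' B\<close>.\<close>

lemma linked_move_point_transversally:
  fixes c :: "nat \<Rightarrow> real ^ 'd"
  assumes n: "CARD('d) + 2 \<le> n"
    and gen: "generic_family n (c(k := x))" "generic_family n (c(k := y))"
    and transv: "\<And>J J'. J \<noteq> J' \<Longrightarrow> J \<subseteq> {1..n} \<Longrightarrow> J' \<subseteq> {1..n} \<Longrightarrow> k \<in> J \<Longrightarrow> k \<in> J' \<Longrightarrow>
      card J = CARD('d) + 1 \<Longrightarrow> card J' = CARD('d) + 1 \<Longrightarrow>
      family_det (c(k := x)) J * family_det (c(k := y)) J' \<noteq>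
      family_det (c(k := x)) J' * family_det (c(k := y)) J"
  shows "linked n (c(k := x) ` {1..n}) (c(k := y) ` {1..n})"
proof (rule linked_segment[OF n gen])
  fix t :: real and J J'
  assume t: "0 \<le> t" "t \<le> 1" and J: "J \<subseteq> {1..n}" "card J = CARD('d) + 1"
    and J': "J' \<subseteq> {1..n}" "card J' = CARD('d) + 1"
    and dep: "affine_dependent_family (c(k := x + t *\<^sub>R (y - x))) J"
      "affine_dependent_family (c(k := x + t *\<^sub>R (y - x))) J'"
  have k: "k \<in> J" if "affine_dependent_family (c(k := x + t *\<^sub>R (y - x))) J"
    "J \<subseteq> {1..n}" "card J = CARD('d) + 1" for J
  proof (rule ccontr)
    assume "k \<notin> J"
    then have "affine_dependent_family (c(k := x + t *\<^sub>R (y - x))) J \<longleftrightarrow>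
        affine_dependent_family (c(k := x)) J"
      unfolding affine_dependent_family_def
      by (intro ex_cong1 conj_cong refl arg_cong[of _ _ "\<lambda>z. z = 0"] sum.cong) auto
    then show False using gen(1) that by (simp add: generic_family_def)
  qed
  show "J = J'"
  proof (rule ccontr)
    assume "J \<noteq> J'"
    then have ne: "family_det (c(k := x)) J * family_det (c(k := y)) J' \<noteq>
      family_det (c(k := x)) J' * family_det (c(k := y)) J"
      using transv J J' k dep by blast
    have 1: "(1 - t) * family_det (c(k := x)) J + t * family_det (c(k := y)) J = 0"
      using family_det_eq_0_iff[OF J(2)] dep(1) family_det_segment[OF J(2)] by metis
    have 2: "(1 - t) * family_det (c(k := x)) J' + t * family_det (c(k := y)) J' = 0"
      using family_det_eq_0_iff[OF J'(2)] dep(2) family_det_segment[OF J'(2)] by metis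
    define A B A' B' where "A = family_det (c(k := x)) J" and "B = family_det (c(k := y)) J"
      and "A' = family_det (c(k := x)) J'" and "B' = family_det (c(k := y)) J'"
    have eq: "(1 - t) * A + t * B = 0" "(1 - t) * A' + t * B' = 0" and ne: "A * B' \<noteq> A' * B"
      using 1 2 ne by (simp_all add: A_def B_def A'_def B'_def)
    have "(1 - t) * (A * B' - A' * B) = ((1 - t) * A + t * B) * B' - ((1 - t) * A' + t * B') * B"
      "t * (A * B' - A' * B) = ((1 - t) * A' + t * B') * A - ((1 - t) * A + t * B) * A'"
      by (simp_all add: algebra_simps)
    then have "(1 - t) * (A * B' - A' * B) = 0" "t * (A * B' - A' * B) = 0" by (simp_all add: eq)
    then show False using ne by simp
  qed
qed

lemma ex_avoiding_affine_zeros: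
  fixes F :: "('a::euclidean_space \<Rightarrow> real) set"
  assumes "finite F" "\<And>f. f \<in> F \<Longrightarrow> \<exists>a b. \<forall>x. f x = a \<bullet> x - b" "\<And>f. f \<in> F \<Longrightarrow> \<exists>x. f x \<noteq> 0"
  shows "\<exists>x. \<forall>f\<in>F. f x \<noteq> 0"
proof -
  have "negligible {x. f x = 0}" if f: "f \<in> F" for f
  proof -
    obtain a b where ab: "\<And>x. f x = a \<bullet> x - b" using assms(2)[OF f] by blast
    then have "a \<noteq> 0 \<or> b \<noteq> 0" using assms(3)[OF f] by auto
    then have "negligible {x. a \<bullet> x = b}" by (rule negligible_hyperplane)
    then show ?thesis by (simp add: ab)
  qed
  then have "negligible (\<Union>f\<in>F. {x. f x = 0})" using assms(1) by (intro negligible_Union) auto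
  then have "(\<Union>f\<in>F. {x. f x = 0}) \<noteq> UNIV" by (metis non_negligible_UNIV)
  then show ?thesis by blast
qed

lemma generic_family_fun_upd:
  fixes c :: "nat \<Rightarrow> real ^ 'd"
  assumes "generic_family n c"
    "\<And>J. J \<subseteq> {1..n} \<Longrightarrow> card J = CARD('d) + 1 \<Longrightarrow> k \<in> J \<Longrightarrow> family_det (c(k := x)) J \<noteq> 0"
  shows "generic_family n (c(k := x))"
  unfolding generic_family_def
proof (intro allI impI)
  fix J assume J: "J \<subseteq> {1..n}" "card J = CARD('d) + 1"
  show "\<not> affine_dependent_family (c(k := x)) J"
  proof (cases "k \<in> J")
    case True
    then show ?thesis using assms(2)[OF J True] family_det_eq_0_iff[OF J(2)] by blast
  next
    case False
    then have "affine_dependent_family (c(k := x)) J \<longleftrightarrow> affine_dependent_family c J"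
      unfolding affine_dependent_family_def
      by (intro ex_cong1 conj_cong refl arg_cong[of _ _ "\<lambda>z. z = 0"] sum.cong) auto
    then show ?thesis using assms(1) J by (simp add: generic_family_def)
  qed
qed

lemma generic_family_det:
  fixes c :: "nat \<Rightarrow> real ^ 'd"
  assumes "generic_family n c" "J \<subseteq> {1..n}" "card J = CARD('d) + 1"
  shows "family_det c J \<noteq> 0"
  using assms family_det_eq_0_iff[OF assms(3), of c] by (auto simp: generic_family_def)

lemma affine_dependent_family_replace:
  fixes c :: "'i \<Rightarrow> real ^ 'd"
  assumes J: "card J = CARD('d) + 1" "k \<in> J" "i \<notin> J"
  shows "affine_dependent_family (c(k := c i)) J \<longleftrightarrow> affine_dependent_family c (insert i (J - {k}))"
proof -
  have "card (J - {k}) = CARD('d)" using J by (simp add: card_Diff_singleton)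
  then obtain e :: "'d \<Rightarrow> 'i" where e: "bij_betw e UNIV (J - {k})" using ex_enumeration by blast
  then have "c(k := c i) \<circ> e = c \<circ> e" by (auto simp: bij_betw_def fun_eq_iff)
  moreover have "insert i (J - {k}) - {i} = J - {k}" using J by auto
  ultimately show ?thesis
    using affine_dependent_family_iff[OF J(2) e, of "c(k := c i)"]
      affine_dependent_family_iff[of i "insert i (J - {k})" e c] e by simp
qed

text \<open>The condition of \<open>linked_move_point_transversally\<close> on the end point \<open>w\<close> is that an affine function
  does not vanish there. This function is not identically zero: consider \<open>w = c i\<close> for \<open>i\<close> in \<open>J'\<close> but not in \<open>J\<close>, where the determinant of \<open>J'\<close> vanishes and that
  of \<open>J\<close> does not.\<close>

lemma ex_transversal_witness:
  fixes c :: "nat \<Rightarrow> real ^ 'd"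
  assumes c: "generic_family n c" and J: "J \<noteq> J'" "J \<subseteq> {1..n}" "J' \<subseteq> {1..n}" "k \<in> J" "k \<in> J'"
      "card J = CARD('d) + 1" "card J' = CARD('d) + 1"
  shows "\<exists>w. family_det c J * family_det (c(k := w)) J' - family_det c J' * family_det (c(k := w)) J \<noteq> 0"
proof -
  have "finite J" "finite J'" using J finite_subset by blast+
  then have "\<not> J' \<subseteq> J" using J card_subset_eq[of J J'] by auto
  then obtain i where i: "i \<in> J'" "i \<notin> J" by blast
  then have ik: "i \<noteq> k" using J by auto
  have "\<not> inj_on (c(k := c i)) J'"
    using inj_onD[of "c(k := c i)" J' i k] ik i(1) J(5) by auto
  then have "affine_dependent_family (c(k := c i)) J'"
    using \<open>finite J'\<close> by (rule affine_dependent_family_not_inj)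
  then have "family_det (c(k := c i)) J' = 0" using family_det_eq_0_iff[OF J(7)] by blast
  moreover have "family_det (c(k := c i)) J \<noteq> 0"
  proof -
    have "card (insert i (J - {k})) = CARD('d) + 1"
      using J i \<open>finite J\<close> by (simp add: card_Diff_singleton)
    moreover have "insert i (J - {k}) \<subseteq> {1..n}" using J i by auto
    ultimately have "\<not> affine_dependent_family c (insert i (J - {k}))"
      using c by (simp add: generic_family_def)
    then show ?thesis
      using affine_dependent_family_replace[OF J(6,4) i(2)] family_det_eq_0_iff[OF J(6)] by blast
  qed
  ultimately show ?thesis using generic_family_det[OF c J(3,7)] by (intro exI[of _ "c i"]) simp
qed

text \<open>The segment from \<open>c k\<close> to \<open>y\<close> itself may meet two hyperplanes at once, so the point moves through
  an intermediate position \<open>w\<close> chosen outside finitely many hyperplanes.\<close>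

lemma linked_move_point:
  fixes c :: "nat \<Rightarrow> real ^ 'd"
  assumes n: "CARD('d) + 2 \<le> n" and c: "generic_family n c" "generic_family n (c(k := y))"
  shows "linked n (c ` {1..n}) (c(k := y) ` {1..n})"
proof -
  let ?c' = "c(k := y)"
  define JJ where "JJ = {J. J \<subseteq> {1..n} \<and> card J = CARD('d) + 1 \<and> k \<in> J}"
  define F where "F = (\<lambda>J w. family_det (c(k := w)) J) ` JJ"
  define G where "G b = (\<lambda>(J, J') w. family_det b J * family_det (b(k := w)) J' -
      family_det b J' * family_det (b(k := w)) J) ` (JJ \<times> JJ - Id)" for b :: "nat \<Rightarrow> real ^ 'd"
  have "finite JJ" by (rule finite_subset[of _ "Pow {1..n}"]) (auto simp: JJ_def)
  have "\<exists>w. \<forall>f\<in>F \<union> G c \<union> G ?c'. f w \<noteq> 0"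
  proof (rule ex_avoiding_affine_zeros)
    show "finite (F \<union> G c \<union> G ?c')" using \<open>finite JJ\<close> by (simp add: F_def G_def)
    fix f assume f: "f \<in> F \<union> G c \<union> G ?c'"
    have G: "(\<exists>a b. \<forall>x. f x = a \<bullet> x - b) \<and> (\<exists>x. f x \<noteq> 0)" if fG: "f \<in> G b" and b: "generic_family n b" for b
    proof -
      obtain J J' where J: "J \<in> JJ" "J' \<in> JJ" "J \<noteq> J'" and f: "\<And>w. f w = family_det b J * family_det (b(k := w)) J' -
          family_det b J' * family_det (b(k := w)) J" using fG by (auto simp: G_def)
      obtain a1 b1 a2 b2 where ab: "\<And>x. family_det (b(k := x)) J = a1 \<bullet> x - b1"
          "\<And>x. family_det (b(k := x)) J' = a2 \<bullet> x - b2"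
        using family_det_move_point J unfolding JJ_def mem_Collect_eq by metis
      have "f x = (family_det b J *\<^sub>R a2 - family_det b J' *\<^sub>R a1) \<bullet> x -
          (family_det b J * b2 - family_det b J' * b1)" for x
        unfolding f ab by (simp add: inner_diff_left algebra_simps)
      moreover have "\<exists>x. f x \<noteq> 0"
        unfolding f using ex_transversal_witness[OF b J(3)] J unfolding JJ_def by blast
      ultimately show ?thesis by blast
    qed
    have F: "(\<exists>a b. \<forall>x. f x = a \<bullet> x - b) \<and> (\<exists>x. f x \<noteq> 0)" if fF: "f \<in> F"
    proof -
      obtain J where J: "J \<in> JJ" and f: "\<And>w. f w = family_det (c(k := w)) J" using fF by (auto simp: F_def)
      have "f (c k) \<noteq> 0" unfolding f using generic_family_det[OF c(1)] J by (simp add: JJ_def)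
      moreover have "\<exists>a b'. \<forall>x. f x = a \<bullet> x - b'"
        unfolding f using family_det_move_point[of J c k] J by (simp add: JJ_def)
      ultimately show ?thesis by blast
    qed
    show "\<exists>a b. \<forall>x. f x = a \<bullet> x - b" "\<exists>x. f x \<noteq> 0" using f G[OF _ c(1)] G[OF _ c(2)] F by blast+
  qed
  then obtain w where w: "\<And>f. f \<in> F \<union> G c \<union> G ?c' \<Longrightarrow> f w \<noteq> 0" by blast
  have genw: "generic_family n (c(k := w))"
  proof (rule generic_family_fun_upd[OF c(1)])
    fix J assume "J \<subseteq> {1..n}" "card J = CARD('d) + 1" "k \<in> J"
    then have "(\<lambda>w. family_det (c(k := w)) J) \<in> F" by (auto simp: F_def JJ_def)
    then show "family_det (c(k := w)) J \<noteq> 0" using w by blast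
  qed
  have transv: "family_det b J * family_det (b(k := w)) J' \<noteq> family_det b J' * family_det (b(k := w)) J"
    if "b = c \<or> b = ?c'" "J \<noteq> J'" "J \<in> JJ" "J' \<in> JJ" for b J J'
  proof -
    have "(\<lambda>w. family_det b J * family_det (b(k := w)) J' - family_det b J' * family_det (b(k := w)) J) \<in> G b"
      unfolding G_def using that by (intro image_eqI[of _ _ "(J, J')"]) auto
    then show ?thesis using w that(1) by fastforce
  qed
  have "linked n (c(k := c k) ` {1..n}) (c(k := w) ` {1..n})"
  proof (rule linked_move_point_transversally[OF n])
    show "family_det (c(k := c k)) J * family_det (c(k := w)) J' \<noteq>
        family_det (c(k := c k)) J' * family_det (c(k := w)) J"
      if "J \<noteq> J'" "J \<subseteq> {1..n}" "J' \<subseteq> {1..n}" "k \<in> J" "k \<in> J'"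
        "card J = CARD('d) + 1" "card J' = CARD('d) + 1" for J J'
      using transv[of c J J'] that by (simp add: JJ_def)
  qed (use c genw in auto)
  moreover have "linked n (c(k := w) ` {1..n}) (c(k := y) ` {1..n})"
  proof (rule linked_move_point_transversally[OF n genw c(2)])
    show "family_det (c(k := w)) J * family_det (c(k := y)) J' \<noteq>
        family_det (c(k := w)) J' * family_det (c(k := y)) J"
      if "J \<noteq> J'" "J \<subseteq> {1..n}" "J' \<subseteq> {1..n}" "k \<in> J" "k \<in> J'"
        "card J = CARD('d) + 1" "card J' = CARD('d) + 1" for J J'
      using transv[of ?c' J' J] that by (simp add: JJ_def mult.commute)
  qed
  ultimately show ?thesis using linked_trans by auto
qed

lemma ex_common_generic_point:
  fixes c c' :: "nat \<Rightarrow> real ^ 'd"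
  assumes c: "generic_family n c" "generic_family n c'"
  shows "\<exists>y. generic_family n (c(k := y)) \<and> generic_family n (c'(k := y))"
proof -
  define JJ where "JJ = {J. J \<subseteq> {1..n} \<and> card J = CARD('d) + 1 \<and> k \<in> J}"
  define F where "F b = (\<lambda>J w. family_det (b(k := w)) J) ` JJ" for b :: "nat \<Rightarrow> real ^ 'd"
  have "finite JJ" by (rule finite_subset[of _ "Pow {1..n}"]) (auto simp: JJ_def)
  have "\<exists>w. \<forall>f\<in>F c \<union> F c'. f w \<noteq> 0"
  proof (rule ex_avoiding_affine_zeros)
    show "finite (F c \<union> F c')" using \<open>finite JJ\<close> by (simp add: F_def)
    fix f assume f: "f \<in> F c \<union> F c'"
    have F: "(\<exists>a b. \<forall>x. f x = a \<bullet> x - b) \<and> (\<exists>x. f x \<noteq> 0)" if fF: "f \<in> F b" and b: "generic_family n b" for b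
    proof -
      obtain J where J: "J \<in> JJ" and f: "\<And>w. f w = family_det (b(k := w)) J" using fF by (auto simp: F_def)
      have "f (b k) \<noteq> 0" unfolding f using generic_family_det[OF b] J by (simp add: JJ_def)
      moreover have "\<exists>a b'. \<forall>x. f x = a \<bullet> x - b'"
        unfolding f using family_det_move_point[of J b k] J by (simp add: JJ_def)
      ultimately show ?thesis by blast
    qed
    show "\<exists>a b. \<forall>x. f x = a \<bullet> x - b" "\<exists>x. f x \<noteq> 0" using f F c by blast+
  qed
  then obtain w where w: "\<And>f. f \<in> F c \<union> F c' \<Longrightarrow> f w \<noteq> 0" by blast
  have "generic_family n (b(k := w))" if "generic_family n b" "F b \<subseteq> F c \<union> F c'" for b
  proof (rule generic_family_fun_upd[OF that(1)])
    fix J assume "J \<subseteq> {1..n}" "card J = CARD('d) + 1" "k \<in> J"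
    then have "(\<lambda>w. family_det (b(k := w)) J) \<in> F b" by (auto simp: F_def JJ_def)
    then show "family_det (b(k := w)) J \<noteq> 0" using w that(2) by blast
  qed
  then show ?thesis using c by blast
qed

section \<open>Connectedness for odd n and odd d\<close>

text \<open>Both families are changed, one index after the other, until they agree.\<close>

lemma linked_generic_families:
  fixes c c' :: "nat \<Rightarrow> real ^ 'd"
  assumes n: "CARD('d) + 2 \<le> n" and c: "generic_family n c" "generic_family n c'"
  shows "linked n (c ` {1..n}) (c' ` {1..n})"
proof -
  have "\<exists>b b'. generic_family n b \<and> generic_family n b' \<and> linked n (c ` {1..n}) (b ` {1..n}) \<and>
      linked n (b' ` {1..n}) (c' ` {1..n}) \<and> (\<forall>i\<in>{1..m}. b i = b' i)" for m
  proof (induction m)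
    case 0
    then show ?case using c linked_refl by (intro exI[of _ c] exI[of _ c']) auto
  next
    case (Suc m)
    then obtain b b' where b: "generic_family n b" "generic_family n b'" "linked n (c ` {1..n}) (b ` {1..n})"
      "linked n (b' ` {1..n}) (c' ` {1..n})" "\<forall>i\<in>{1..m}. b i = b' i" by blast
    obtain y where y: "generic_family n (b(Suc m := y))" "generic_family n (b'(Suc m := y))"
      using ex_common_generic_point[OF b(1,2)] by blast
    have "linked n (b ` {1..n}) (b(Suc m := y) ` {1..n})" by (rule linked_move_point[OF n b(1) y(1)])
    moreover have "linked n (b'(Suc m := y) ` {1..n}) (b' ` {1..n})"
      using linked_move_point[OF n y(2), of "Suc m" "b' (Suc m)"] b(2) by simp
    moreover have "\<forall>i\<in>{1..Suc m}. (b(Suc m := y)) i = (b'(Suc m := y)) i" using b(5) by auto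
    ultimately show ?case using y b linked_trans by blast
  qed
  then obtain b b' where b: "linked n (c ` {1..n}) (b ` {1..n})" "linked n (b' ` {1..n}) (c' ` {1..n})"
      "\<forall>i\<in>{1..n}. b i = b' i" by blast
  have "b ` {1..n} = b' ` {1..n}" using b(3) by (intro image_cong) auto
  then show ?thesis using b linked_trans by metis
qed

text \<open>With at most \<open>d\<close> points there are no simplices of dimension \<open>d\<close>, and all configurations are
  isomorphic.\<close>

lemma linked_few_points:
  fixes c c' :: "nat \<Rightarrow> real ^ 'd"
  assumes n: "1 \<le> n" "n \<le> CARD('d)"
    and gen: "generic_config n (c ` {1..n})" "generic_config n (c' ` {1..n})"
  shows "linked n (c ` {1..n}) (c' ` {1..n})"
proof (rule linked_same_orientations[OF n(1) gen])
  have False if "i \<in> {1..n}" "inj e" "range e \<subseteq> {1..n} - {i}" for i and e :: "'d \<Rightarrow> nat"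
    using card_mono[OF _ indexed_simplex(1)[OF that]] indexed_simplex(2)[OF that] n by simp
  then show "same_orientations_except {1..n} {} c c'" unfolding same_orientations_except_def by blast
qed

text \<open>For \<open>n = d + 1\<close> there is no index outside the flipset, as needed for \<open>linked_line_flip\<close>. This case does
  not arise when \<open>d\<close> and \<open>n\<close> are both odd.\<close>

lemma linked_generic_configs:
  fixes P P' :: "(real ^ 'd) set"
  assumes P: "generic_config n P" "generic_config n P'" and n: "1 \<le> n" "n \<noteq> CARD('d) + 1"
  shows "linked n P P'"
proof -
  have ex: "\<exists>c. Q = c ` {1..n}" if "generic_config n Q" for Q :: "(real ^ 'd) set"
    using ex_bij_betw_nat_finite_1[OF generic_configD(1)[OF that]] generic_configD(2)[OF that]
    by (auto simp: bij_betw_def)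
  obtain c c' where c: "P = c ` {1..n}" "P' = c' ` {1..n}"
    using ex[OF P(1)] ex[OF P(2)] by blast
  show ?thesis
  proof (cases "n \<le> CARD('d)")
    case True
    then show ?thesis using linked_few_points n P unfolding c by blast
  next
    case False
    then have "CARD('d) + 2 \<le> n" using n by simp
    then show ?thesis using linked_generic_families generic_config_family(2) P unfolding c by blast
  qed
qed

lemma ex_generic_config: "\<exists>P :: (real ^ 'd) set. generic_config n P"
proof (induction n)
  case 0
  have "generic_config 0 ({} :: (real ^ 'd) set)" by (auto simp: generic_config_def)
  then show ?case by blast
next
  case (Suc n)
  then obtain P :: "(real ^ 'd) set" where P: "generic_config n P" by blast
  have fin: "finite P" using generic_configD(1)[OF P] .
  have neg: "negligible (affine hull T)" if "finite T" "card T \<le> CARD('d)" for T :: "(real ^ 'd) set"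
  proof -
    have "aff_dim (affine hull T) < DIM(real ^ 'd)"
      using aff_dim_le_card[OF that(1)] that(2) by (simp add: aff_dim_affine_hull)
    then obtain a b where "a \<noteq> 0" "affine hull T \<subseteq> {x. a \<bullet> x = b}" by (rule aff_lowdim_subset_hyperplane)
    then show ?thesis using negligible_hyperplane negligible_subset by blast
  qed
  have "negligible (\<Union>T\<in>{T. T \<subseteq> P \<and> card T \<le> CARD('d)}. affine hull T)"
    using fin by (intro negligible_Union) (auto intro!: neg intro: finite_subset)
  \<comment> \<open>Hence there is room for one more point outside these affine hulls.\<close>
  then have "(\<Union>T\<in>{T. T \<subseteq> P \<and> card T \<le> CARD('d)}. affine hull T) \<noteq> UNIV"
    by (metis non_negligible_UNIV)
  then obtain x where x: "\<And>T. T \<subseteq> P \<Longrightarrow> card T \<le> CARD('d) \<Longrightarrow> x \<notin> affine hull T" by blast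
  have "x \<notin> P" using x[of "{x}"] by (auto simp: Suc_leI)
  have "\<not> affine_dependent T" if T: "T \<subseteq> insert x P" "card T \<le> CARD('d) + 1" for T
  proof (cases "x \<in> T")
    case True
    have finT: "finite T" using T(1) fin finite_subset by blast
    have T': "T - {x} \<subseteq> P" "card (T - {x}) \<le> CARD('d)"
      using T True finT by (auto simp: card_Diff_singleton)
    then have "\<not> affine_dependent (T - {x})" by (intro generic_configD(3)[OF P]) auto
    then have "\<not> affine_dependent (insert x (T - {x}))"
      using x[OF T'] by (rule affine_independent_insert)
    then show ?thesis using True by (simp add: insert_absorb)
  next
    case False
    then show ?thesis using T by (intro generic_configD(3)[OF P]) auto
  qed
  then have "generic_config (Suc n) (insert x P)"
    using generic_configD[OF P] \<open>x \<notin> P\<close> by (simp add: generic_config_def)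
  then show ?case by blast
qed

lemma adjacent_same_parity:
  assumes n: "n \<ge> 1" and d: "odd CARD('d::finite)"
    and XY: "(X, Y) \<in> (adjacent n :: ('d pconfig set \<times> 'd pconfig set) set)\<^sup>*"
  shows "X \<in> parity_verts n k \<longleftrightarrow> Y \<in> parity_verts n k"
  using XY
proof (induction rule: rtrancl_induct)
  case (step Y Z)
  then have "{Y, Z} \<in> flip_graph_edges n" by (simp add: adjacent_def)
  then obtain X' Y' where XY: "{Y, Z} = {X', Y'}" "X' \<in> flip_graph_verts n" "Y' \<in> flip_graph_verts n"
    "\<forall>k. X' \<in> parity_verts n k \<longleftrightarrow> Y' \<in> parity_verts n (k + CARD('d) + 1)"
    by (rule flip_graph_edgeE[OF _ n]) blast
  have "parity_verts n (k + CARD('d) + 1) = (parity_verts n k :: 'd pconfig set set)"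
    using d by (intro parity_verts_mod2) presburger
  then have "X' \<in> parity_verts n k \<longleftrightarrow> Y' \<in> parity_verts n k" using XY(4) by simp
  moreover have "Y = X' \<and> Z = Y' \<or> Y = Y' \<and> Z = X'" using XY(1) by (auto simp: doubleton_eq_iff)
  ultimately show ?case using step.IH by blast
qed simp

lemma cong_mod_2_even_add:
  fixes a b k :: nat
  assumes "[a = k] (mod 2)" "[b = k] (mod 2)"
  shows "even (a + b)"
proof -
  have "even a \<longleftrightarrow> even k" "even b \<longleftrightarrow> even k"
    using assms unfolding cong_def even_iff_mod_2_eq_zero by simp_all
  then show ?thesis by simp
qed

text \<open>A path of flips leads from \<open>P\<close> to \<open>P'\<close>. It carries the selected class to an Orchard class of \<open>P'\<close> of
  the same parity, and only one of the two classes of \<open>P'\<close> has this parity because \<open>n\<close> is odd.\<close>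

lemma same_parity_connected:
  fixes X Y :: "'d::finite pconfig set"
  assumes n: "n \<ge> 1" "odd n" and d: "odd CARD('d)"
    and XY: "X \<in> parity_verts n k" "Y \<in> parity_verts n k"
  shows "(X, Y) \<in> (adjacent n)\<^sup>*"
proof -
  have XV: "X \<in> flip_graph_verts n" "Y \<in> flip_graph_verts n" using XY by (auto simp: parity_verts_def)
  obtain P S where PS: "(P, S) \<in> pconfigs n" "X = pconfig_class n (P, S)" using flip_graph_vertE[OF XV(1)] .
  obtain P' S' where PS': "(P', S') \<in> pconfigs n" "Y = pconfig_class n (P', S')" using flip_graph_vertE[OF XV(2)] .
  have "n \<noteq> CARD('d) + 1" using n d by auto
  then have "linked n P P'" using linked_generic_configs n(1) pconfigsD(1)[OF PS(1) n(1)] pconfigsD(1)[OF PS'(1) n(1)] by blast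
  then obtain S'' where S'': "(P', S'') \<in> pconfigs n"
    and conn: "(X, pconfig_class n (P', S'')) \<in> (adjacent n)\<^sup>*"
    using PS unfolding linked_def by blast
  define Y' where "Y' = pconfig_class n (P', S'')"
  have Y': "Y' \<in> flip_graph_verts n" using S'' by (simp add: Y'_def flip_graph_verts_def quotientI)
  have mem: "(P', S'') \<in> Y'" "(P', S') \<in> Y" using equiv_class_self[OF equiv_pconfig_iso_rel[OF n(1)]] S'' PS'
    by (auto simp: Y'_def)
  have "Y' \<in> parity_verts n k" using adjacent_same_parity[OF n(1) d conn] XY(1) by (simp add: Y'_def)
  then have par: "[card S'' = k] (mod 2)" "[card S' = k] (mod 2)"
    using parity_verts_iff[OF n(1) Y' mem(1)] parity_verts_iff[OF n(1) XV(2) mem(2)] XY(2) by auto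
  note D = pconfigsD[OF PS'(1) n(1)] and D'' = pconfigsD[OF S'' n(1)]
  have "S'' \<noteq> P' - S'"
  proof
    assume "S'' = P' - S'"
    then have "card S'' + card S' = n"
      using card_Diff_subset[OF D(5,4)] card_mono[OF generic_configD(1)[OF D(1)] D(4)] generic_configD(2)[OF D(1)] by simp
    moreover have "even (card S'' + card S')" using par by (rule cong_mod_2_even_add)
    ultimately show False using n(2) by simp
  qed
  then have "S'' = S'" using orchard_classes_unique[OF D(1,2,3) D''(3)] by blast
  then show ?thesis using conn PS' by simp
qed

lemma ex_parity_vert:
  assumes n: "n \<ge> 1" "odd n"
  shows "\<exists>X. X \<in> (parity_verts n k :: 'd::finite pconfig set set)"
proof -
  obtain P :: "(real ^ 'd) set" where P: "generic_config n P" using ex_generic_config by blast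
  have ne: "P \<noteq> {}" using generic_configD(2)[OF P] n by auto
  obtain S where S: "S \<in> orchard_classes P" using orchard_classes_nonempty[OF ne] by blast
  have in_pc: "(P, S) \<in> pconfigs n" "(P, P - S) \<in> pconfigs n"
    using P S orchard_classes_complement[OF P ne S] by (auto simp: pconfigs_def)
  note D = pconfigsD[OF in_pc(1) n(1)]
  have "card S + card (P - S) = n"
    using card_Diff_subset[OF D(5,4)] card_mono[OF generic_configD(1)[OF D(1)] D(4)] generic_configD(2)[OF D(1)] by simp
  then have "odd (card S + card (P - S))" using n(2) by simp
  then have "[card S = k] (mod 2) \<or> [card (P - S) = k] (mod 2)" by (auto simp: cong_def mod2_eq_if)
  then obtain T where T: "(P, T) \<in> pconfigs n" "[card T = k] (mod 2)" using in_pc by blast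
  have "pconfig_class n (P, T) \<in> flip_graph_verts n" "(P, T) \<in> pconfig_class n (P, T)"
    using T(1) equiv_class_self[OF equiv_pconfig_iso_rel[OF n(1)]] by (auto simp: flip_graph_verts_def quotientI)
  then show ?thesis using parity_verts_iff[OF n(1)] T(2) by blast
qed

lemma connected_components_parity:
  assumes n: "n \<ge> 1" "odd n" and d: "odd CARD('d::finite)"
  shows "connected_components (flip_graph_verts n :: 'd pconfig set set) (flip_graph_edges n) =
    {parity_verts n 0, parity_verts n 1}"
proof -
  let ?V = "flip_graph_verts n :: 'd pconfig set set"
  let ?R = "{(x, y). x \<in> ?V \<and> y \<in> ?V \<and> (x, y) \<in> {(u, v). {u, v} \<in> flip_graph_edges n}\<^sup>*}"
  have sub: "parity_verts n k \<subseteq> ?V" for k by (auto simp: parity_verts_def)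
  have cls: "?R `` {X} = parity_verts n k" if X: "X \<in> parity_verts n k" for X k
    using adjacent_same_parity[OF n(1) d, of X _ k] same_parity_connected[OF n d X] sub X
    unfolding adjacent_def by blast
  have "?V // ?R = {parity_verts n 0, parity_verts n 1}"
  proof (intro equalityI subsetI)
    fix C assume "C \<in> ?V // ?R"
    then obtain X where "X \<in> ?V" "C = ?R `` {X}" by (rule quotientE)
    then show "C \<in> {parity_verts n 0, parity_verts n 1}"
      using parity_verts_0_iff_not_1[of X n] n cls by blast
  next
    fix C :: "'d pconfig set set" assume "C \<in> {parity_verts n 0, parity_verts n 1}"
    then obtain k where C: "C = parity_verts n k" by auto
    obtain X where X: "X \<in> (parity_verts n k :: 'd pconfig set set)" using ex_parity_vert[OF n] by blast
    then have "?R `` {X} \<in> ?V // ?R" using sub by (intro quotientI) auto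
    then show "C \<in> ?V // ?R" unfolding cls[OF X] C .
  qed
  then show ?thesis by (simp add: connected_components_def)
qed

theorem corollary1p4:
  fixes n :: nat
  assumes "n \<ge> 1"
  shows
    "(even CARD('d::finite) \<longrightarrow>
        is_bipartition (flip_graph_verts n :: 'd pconfig set set) (flip_graph_edges n)
          (parity_verts n 0) (parity_verts n 1)) \<and>
     (odd CARD('d) \<and> odd n \<longrightarrow>
        (let comps = connected_components (flip_graph_verts n :: 'd pconfig set set)
                       (flip_graph_edges n)
         in card comps = 2 \<and> (\<forall>C \<in> comps. \<exists>k. C \<subseteq> parity_verts n k))) \<and>
     (odd CARD('d) \<and> even n \<longrightarrow>
        (\<exists>\<pi> \<in> {0, 1 :: nat}. \<forall>P :: (real ^ 'd) set. generic_config n P \<longrightarrow>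
           (\<forall>A \<in> orchard_classes P. [card A = \<pi>] (mod 2))))"
proof (intro conjI impI)
  assume "even CARD('d)"
  then show "is_bipartition (flip_graph_verts n :: 'd pconfig set set) (flip_graph_edges n)
          (parity_verts n 0) (parity_verts n 1)"
    by (rule flip_graph_bipartite[OF assms])
next
  assume odd: "odd CARD('d) \<and> odd n"
  let ?c = "connected_components (flip_graph_verts n :: 'd pconfig set set) (flip_graph_edges n)"
  have comps: "?c = {parity_verts n 0, parity_verts n 1}"
    using connected_components_parity[OF assms] odd by blast
  obtain X where X: "X \<in> (parity_verts n 0 :: 'd pconfig set set)"
    using ex_parity_vert[OF assms] odd by blast
  then have "X \<in> flip_graph_verts n" by (simp add: parity_verts_def)
  then have "X \<notin> parity_verts n 1" using parity_verts_0_iff_not_1[OF _ assms] X by blast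
  then have "parity_verts n 0 \<noteq> (parity_verts n 1 :: 'd pconfig set set)" using X by blast
  then have "card ?c = 2" unfolding comps by simp
  moreover have "\<forall>C\<in>?c. \<exists>k. C \<subseteq> parity_verts n k" unfolding comps by blast
  ultimately show "let comps = ?c in card comps = 2 \<and> (\<forall>C \<in> comps. \<exists>k. C \<subseteq> parity_verts n k)"
    by (simp add: Let_def)
next
  assume par: "odd CARD('d) \<and> even n"
  define K where "K = int_binomial (int n - 3) (CARD('d) - 1) *
      int (card {(i, j). i \<in> {1..n} \<and> j \<in> {1..n} \<and> i < j})"
  define \<pi> where "\<pi> = (if even K then 0 else 1 :: nat)"
  have "[card A = \<pi>] (mod 2)" if "generic_config n P" "A \<in> orchard_classes P"
    for P A :: "(real ^ 'd) set"
  proof -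
    have "even (int (card A) + K)"
      unfolding K_def using card_orchard_class_parity[OF that(1) assms _ _ that(2)] par by blast
    then show ?thesis by (auto simp: \<pi>_def cong_def mod2_eq_if)
  qed
  moreover have "\<pi> \<in> {0, 1}" by (simp add: \<pi>_def)
  ultimately show "\<exists>\<pi> \<in> {0, 1 :: nat}. \<forall>P :: (real ^ 'd) set. generic_config n P \<longrightarrow>
      (\<forall>A \<in> orchard_classes P. [card A = \<pi>] (mod 2))" by blast
qed

end
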